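(* Let $r\ge 2$, and let $n,\Delta$ be integers with $\lceil (r-1)n/r\rceil\le \Delta\le n-1$. Let $S_{n,\Delta}^{(r)}:=(n-\Delta)K_1\vee T(\Delta,r-1)$. Then for every $n$-vertex $K_{r+1}$-free graph $G$ with maximum degree $\Delta(G)=\Delta$: (i) $e(G)\le e(S_{n,\Delta}^{(r)})=(n-\Delta)\Delta+t(\Delta,r-1)$, with equality if and only if $G\cong S_{n,\Delta}^{(r)}$; (ii) $\rho(G)\le \rho(S_{n,\Delta}^{(r)})$, with equality if and only if $G\cong S_{n,\Delta}^{(r)}$.
   Context: All graphs are finite, simple and undirected. A graph is $F$-free if it contains no copy of $F$ as a (not necessarily induced) subgraph. $e(G)$ is the number of edges, $\Delta(G)$ the maximum degree, and $\rho(G)$ the spectral radius of the adjacency matrix of $G$. $T(m,p)$ is the balanced complete $p$-partite graph on $m$ vertices (part sizes differ by at most $1$), and $t(m,p):=e(T(m,p))$; in particular $T(m,1)$ is the edgeless graph on $m$ vertices. $G\vee H$ is the join of vertex-disjoint graphs, and $qK_1$ is the edgeless graph on $q$ vertices. Thus $S_{n,\Delta}^{(r)}$ is the complete $r$-partite graph with one part of size $n-\Delta$ and the remaining $\Delta$ vertices split as equally as possible among the other $r-1$ parts. *)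

theory Defs
  imports
    "Graph_Theory.Pair_Digraph"
    "Graph_Theory.Digraph_Isomorphism"
    "Graph_Theory.Kuratowski"
    "Jordan_Normal_Form.Spectral_Radius"
begin

text \<open>
  A finite simple undirected graph is a \<^term>\<open>pair_graph\<close>: a finite loop-free digraph without
  parallel arcs whose arc relation is symmetric. Each undirected edge is therefore represented by
  two arcs, and for such graphs \<^term>\<open>digraph_iso\<close> is ordinary graph isomorphism.
\<close>

definition complete_free :: "nat \<Rightarrow> 'a pair_pre_digraph \<Rightarrow> bool" where
  "complete_free m G \<longleftrightarrow> \<not> (\<exists>H. subgraph H (with_proj G) \<and> K\<^bsub>m\<^esub> H)"

definition edge_count :: "'a pair_pre_digraph \<Rightarrow> nat" where
  "edge_count G = card {{u, v} | u v. (u, v) \<in> parcs G}"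

text \<open>By symmetry of the arcs, the out-degree of a vertex is its degree as an undirected graph.\<close>

definition max_degree :: "'a pair_pre_digraph \<Rightarrow> nat" where
  "max_degree G = Max (out_degree (with_proj G) ` pverts G)"

definition adjacency_mat :: "'a list \<Rightarrow> 'a pair_pre_digraph \<Rightarrow> complex mat" where
  "adjacency_mat vs G = mat (length vs) (length vs)
     (\<lambda>(i, j). if (vs ! i, vs ! j) \<in> parcs G then 1 else 0)"

text \<open>
  The vertex type carries no order, so an enumeration of the vertices is chosen. Another choice
  conjugates the matrix by a permutation matrix and does not change the spectrum.
\<close>

definition graph_spectral_radius :: "'a pair_pre_digraph \<Rightarrow> real" where
  "graph_spectral_radius G =
     spectral_radius (adjacency_mat (SOME vs. distinct vs \<and> set vs = pverts G) G)"

definition edgeless :: "nat \<Rightarrow> nat pair_pre_digraph" where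
  "edgeless q = \<lparr> pverts = {..<q}, parcs = {} \<rparr>"

text \<open>
  The parts of the balanced complete \<^term>\<open>p\<close>-partite graph are the residue classes modulo
  \<^term>\<open>p\<close> in \<^term>\<open>{..<m}\<close> (for \<^term>\<open>p > (0::nat)\<close>).
\<close>

definition turan_graph :: "nat \<Rightarrow> nat \<Rightarrow> nat pair_pre_digraph" where
  "turan_graph m p =
     \<lparr> pverts = {..<m}, parcs = {(u, v). u < m \<and> v < m \<and> u mod p \<noteq> v mod p} \<rparr>"

definition turan_number :: "nat \<Rightarrow> nat \<Rightarrow> nat" where
  "turan_number m p = edge_count (turan_graph m p)"

text \<open>The sum type makes the two vertex sets disjoint.\<close>

definition graph_join ::
    "'a pair_pre_digraph \<Rightarrow> 'b pair_pre_digraph \<Rightarrow> ('a + 'b) pair_pre_digraph" where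
  "graph_join G H =
     \<lparr> pverts = pverts G <+> pverts H,
       parcs = map_prod Inl Inl ` parcs G \<union> map_prod Inr Inr ` parcs H
         \<union> (Inl ` pverts G) \<times> (Inr ` pverts H) \<union> (Inr ` pverts H) \<times> (Inl ` pverts G) \<rparr>"

definition S_graph :: "nat \<Rightarrow> nat \<Rightarrow> nat \<Rightarrow> (nat + nat) pair_pre_digraph" where
  "S_graph r n \<Delta> = graph_join (edgeless (n - \<Delta>)) (turan_graph \<Delta> (r - 1))"

lemma pair_graph_edgeless: "pair_graph (edgeless q)"
  by unfold_locales (auto simp: edgeless_def symmetric_def sym_def)

lemma pair_graph_turan_graph: "pair_graph (turan_graph m p)"
proof -
  have "finite {(u, v). u < m \<and> v < m \<and> u mod p \<noteq> v mod p}"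
    by (rule finite_subset[of _ "{..<m} \<times> {..<m}"]) auto
  then show ?thesis
    by unfold_locales (auto simp: turan_graph_def symmetric_def sym_def)
qed

lemma pair_graph_graph_join:
  assumes "pair_graph G" "pair_graph H"
  shows "pair_graph (graph_join G H)"
proof -
  interpret G: pair_graph G by fact
  interpret H: pair_graph H by fact
  have sym: "sym (parcs G)" "sym (parcs H)"
    using G.sym_arcs H.sym_arcs by (auto simp: symmetric_def)
  show ?thesis
  proof unfold_locales
    show "symmetric (with_proj (graph_join G H))"
      using sym by (fastforce simp: graph_join_def symmetric_def sym_def)
  qed (auto simp: graph_join_def G.in_arcsD1 G.in_arcsD2 H.in_arcsD1 H.in_arcsD2
         dest: G.pair_no_loops H.pair_no_loops
         intro: G.pair_finite_verts H.pair_finite_verts G.pair_finite_arcs H.pair_finite_arcs)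
qed

lemma turan_graph_balanced:
  assumes "i < p"
  shows "card {u \<in> pverts (turan_graph m p). u mod p = i}
           = m div p + (if i < m mod p then 1 else 0)"
proof -
  let ?k = "m div p + (if i < m mod p then 1 else 0)"
  have lt: "i + p * q < m \<longleftrightarrow> q < ?k" for q
  proof -
    have m: "m = p * (m div p) + m mod p" by simp
    have "m mod p < p" using assms by simp
    show ?thesis
    proof (cases "q < m div p")
      case True
      then have "p * (q + 1) \<le> p * (m div p)" by (intro mult_le_mono2) simp
      then have "i + p * q < m" using m assms unfolding distrib_left mult_1_right by linarith
      then show ?thesis using True by simp
    next
      case False
      show ?thesis
      proof (cases "q = m div p")
        case True
        have "i + p * (m div p) < m \<longleftrightarrow> i < m mod p" using m by linarith
        then show ?thesis using True by simp
      next
        case neq: False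
        with False have "p * (m div p + 1) \<le> p * q" by (intro mult_le_mono2) simp
        then have "\<not> i + p * q < m"
          using m \<open>m mod p < p\<close> unfolding distrib_left mult_1_right by linarith
        then show ?thesis using False neq by simp
      qed
    qed
  qed
  have "{u \<in> pverts (turan_graph m p). u mod p = i} = (\<lambda>q. i + p * q) ` {..<?k}"
  proof (intro equalityI subsetI)
    fix u assume u: "u \<in> {u \<in> pverts (turan_graph m p). u mod p = i}"
    then have "u = i + p * (u div p)" using mod_mult_div_eq[of u p] by simp
    moreover from u have "u < m" by (simp add: turan_graph_def)
    ultimately show "u \<in> (\<lambda>q. i + p * q) ` {..<?k}"
      using lt[of "u div p"] by (metis imageI lessThan_iff)
  next
    fix u assume "u \<in> (\<lambda>q. i + p * q) ` {..<?k}"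
    then show "u \<in> {u \<in> pverts (turan_graph m p). u mod p = i}"
      using assms by (auto simp only: turan_graph_def pair_pre_digraph.simps lt lessThan_iff
          mem_Collect_eq mod_mult_self2 mod_less)
  qed
  moreover have "inj_on (\<lambda>q. i + p * q) {..<?k}" using assms by (auto simp: inj_on_def)
  ultimately show ?thesis by (simp add: card_image)
qed

end

theory Submission
  imports Defs
begin

text \<open>
  Let \<open>v\<close> have degree \<open>\<Delta>\<close>. A clique of \<open>G\<close> either lies in the neighbourhood \<open>N\<close> of \<open>v\<close> or contains one of the
  \<open>n - \<Delta>\<close> vertices \<open>u\<close> outside \<open>N\<close>, and then the rest of it lies in the neighbourhood of \<open>u\<close>. These
  neighbourhoods contain no \<open>r\<close>-clique and have at most \<open>\<Delta>\<close> vertices, so Zykov's theorem yields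
  \<open>k s G \<le> k s S\<close> for the numbers \<open>k s\<close> of \<open>s\<close>-cliques of \<open>G\<close> and of the graph \<open>S\<close> of the theorem. The case \<open>s = 2\<close>
  is the edge bound; equality there forces the vertices outside \<open>N\<close> to be independent and joined to
  all of \<open>N\<close>, and \<open>N\<close> to induce the Turan graph.

  For the spectral radius, the Bollobas--Nikiforov inequality
  \<open>\<rho> ^ r \<le> (\<Sum>s = 2..r. (s - 1) * k s * \<rho> ^ (r - s))\<close> holds for graphs without \<open>(r + 1)\<close>-cliques and is an
  equality for a positive eigenvalue of \<open>S\<close>. Monotonicity in the coefficients \<open>k s\<close> gives
  \<open>\<rho>(G) \<le> \<rho>(S)\<close>, and equality forces equality of the numbers of edges.
\<close>

section \<open>Elementary symmetric functions of part sizes\<close>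

text \<open>The coefficient of \<open>x ^ s\<close> counts the \<open>s\<close>-cliques of the complete multipartite graph with part
  sizes \<open>n 0, \<dots>, n (p - 1)\<close>.\<close>

definition parts_poly :: "(nat \<Rightarrow> nat) \<Rightarrow> nat \<Rightarrow> nat poly" where
  "parts_poly n p = (\<Prod>i<p. [:1, n i:])"

text \<open>The part sizes of the Turan graph. Counting a residue class instead of giving a closed
  form makes monotonicity in \<open>m\<close> and the total \<open>m\<close> plain facts about
  sets.\<close>

definition bal :: "nat \<Rightarrow> nat \<Rightarrow> nat \<Rightarrow> nat" where
  "bal m p i = card {u. u < m \<and> u mod p = i}"

lemma bal_eq:
  assumes "i < p"
  shows "bal m p i = m div p + (if i < m mod p then 1 else 0)"
  using turan_graph_balanced[OF assms, of m] by (simp add: bal_def turan_graph_def)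

lemma bal_mono: "d \<le> m \<Longrightarrow> bal d p i \<le> bal m p i"
  unfolding bal_def by (rule card_mono) auto

lemma sum_bal:
  assumes "p > 0"
  shows "(\<Sum>i<p. bal m p i) = m"
proof -
  have "(\<Sum>i<p. bal m p i) = card (\<Union>i<p. {u. u < m \<and> u mod p = i})"
    unfolding bal_def by (subst card_UN_disjoint) auto
  also have "(\<Union>i<p. {u. u < m \<and> u mod p = i}) = {..<m}"
    using assms by auto
  finally show ?thesis by simp
qed

lemma coeff_linear_mult_Suc: "coeff ([:1, a:] * P) (Suc s) = coeff P (Suc s) + a * coeff P s"
  for P :: "nat poly"
  by simp

lemma parts_poly_Suc: "parts_poly n (Suc p) = [:1, n p:] * parts_poly n p"
  by (simp add: parts_poly_def lessThan_Suc del: mult_pCons_left)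

lemma coeff_0_parts_poly [simp]: "coeff (parts_poly n p) 0 = 1"
  unfolding parts_poly_def by (induction p) (auto simp: coeff_mult_0 lessThan_Suc)

lemma coeff_1_parts_poly: "coeff (parts_poly n p) (Suc 0) = (\<Sum>i<p. n i)"
proof (induction p)
  case (Suc p)
  then show ?case using coeff_0_parts_poly[of n p]
    by (simp add: parts_poly_Suc)
qed (simp add: parts_poly_def)

section \<open>Monotonicity and symmetry in the part sizes\<close>

lemma coeff_mult_mono:
  fixes P P' Q Q' :: "nat poly"
  assumes "\<And>s. coeff P s \<le> coeff P' s" "\<And>s. coeff Q s \<le> coeff Q' s"
  shows "coeff (P * Q) s \<le> coeff (P' * Q') s"
  unfolding coeff_mult by (intro sum_mono mult_mono assms) auto

lemma coeff_parts_poly_mono: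
  assumes "\<And>i. i < p \<Longrightarrow> n i \<le> n' i"
  shows "coeff (parts_poly n p) s \<le> coeff (parts_poly n' p) s"
  using assms
proof (induction p arbitrary: s)
  case (Suc p)
  show ?case unfolding parts_poly_Suc
    by (rule coeff_mult_mono) (use Suc in \<open>auto simp: coeff_pCons split: nat.splits\<close>)
qed (simp add: parts_poly_def)

lemma parts_poly_permute:
  assumes "bij_betw \<pi> {..<p} {..<p}" "\<And>i. i < p \<Longrightarrow> n i = n' (\<pi> i)"
  shows "parts_poly n p = parts_poly n' p"
proof -
  have "parts_poly n p = (\<Prod>i<p. [:1, n' (\<pi> i):])"
    unfolding parts_poly_def using assms(2) by simp
  also have "\<dots> = parts_poly n' p"
    unfolding parts_poly_def by (rule prod.reindex_bij_betw[OF assms(1)])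
  finally show ?thesis .
qed

text \<open>Moving one vertex from a part to one smaller by at least two keeps the sum of the two
  sizes and raises their product, while the other factors have nonnegative coefficients. The falling
  sum of squares is the measure for repeating the move.\<close>

lemma parts_poly_shift:
  fixes n :: "nat \<Rightarrow> nat"
  assumes "i < p" "j < p" "i \<noteq> j" "n j + 2 \<le> n i"
  defines "n' \<equiv> n(i := n i - 1, j := n j + 1)"
  shows "coeff (parts_poly n p) s \<le> coeff (parts_poly n' p) s"
    and "coeff (parts_poly n p) 2 < coeff (parts_poly n' p) 2"
    and "(\<Sum>k<p. n' k) = (\<Sum>k<p. n k)"
    and "(\<Sum>k<p. (n' k)\<^sup>2) < (\<Sum>k<p. (n k)\<^sup>2)"
proof -
  let ?A = "{..<p} - {i} - {j}"
  define R where "R = (\<Prod>k\<in>?A. [:1, n k:])"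
  have R': "R = (\<Prod>k\<in>?A. [:1, n' k:])"
    unfolding R_def by (rule prod.cong) (auto simp: n'_def)
  have j: "j \<in> {..<p} - {i}" using assms by auto
  have P: "parts_poly n p = [:1, n i:] * ([:1, n j:] * R)"
    unfolding parts_poly_def R_def
    using assms(1) j by (simp only: prod.remove[of "{..<p}" i] prod.remove[of "{..<p} - {i}" j] finite_lessThan finite_Diff lessThan_iff)
  have P': "parts_poly n' p = [:1, n i - 1:] * ([:1, n j + 1:] * R)"
    unfolding parts_poly_def R'
    using assms(1,3) j by (simp only: prod.remove[of "{..<p}" i] prod.remove[of "{..<p} - {i}" j] finite_lessThan finite_Diff lessThan_iff) (simp add: n'_def)
  \<comment> \<open>Writing the excess as \<open>a\<close> removes the subtraction on natural
    numbers; the product of the two sizes rises by exactly \<open>a + 1\<close>.\<close>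
  obtain a where a: "n i = n j + 2 + a" using assms(4) le_Suc_ex by blast
  have eq: "[:1, n i - 1:] * [:1, n j + 1:] = [:1, n i:] * [:1, n j:] + monom (a + 1) 2"
    unfolding a by (simp add: monom_Suc monom_0 numeral_2_eq_2 algebra_simps)
  have PP: "parts_poly n' p = parts_poly n p + monom (a + 1) 2 * R"
    unfolding P P' mult.assoc[symmetric] eq by (simp only: distrib_right)
  show "coeff (parts_poly n p) s \<le> coeff (parts_poly n' p) s"
    unfolding PP by simp
  \<comment> \<open>The constant term of \<open>R\<close> carries the gain \<open>a + 1\<close> to
    the coefficient of index \<open>2\<close>, which makes that one strict.\<close>
  have "coeff R 0 = 1" unfolding R_def
    by (simp add: poly_prod flip: poly_0_coeff_0)
  then show "coeff (parts_poly n p) 2 < coeff (parts_poly n' p) 2"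
    unfolding PP by (simp add: coeff_monom_mult)
  have *: "(\<Sum>k<p. f (n k)) = f (n i) + (f (n j) + (\<Sum>k\<in>?A. f (n k)))" for f :: "nat \<Rightarrow> nat"
    using assms(1) j by (simp only: sum.remove[of "{..<p}" i] sum.remove[of "{..<p} - {i}" j] finite_lessThan finite_Diff lessThan_iff)
  have "(\<Sum>k<p. f (n' k)) = f (n' i) + (f (n' j) + (\<Sum>k\<in>?A. f (n' k)))" for f :: "nat \<Rightarrow> nat"
    using assms(1) j by (simp only: sum.remove[of "{..<p}" i] sum.remove[of "{..<p} - {i}" j] finite_lessThan finite_Diff lessThan_iff)
  moreover have "(\<Sum>k\<in>?A. f (n' k)) = (\<Sum>k\<in>?A. f (n k))" for f :: "nat \<Rightarrow> nat"
    by (rule sum.cong) (auto simp: n'_def)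
  moreover have "n' i = n j + 1 + a" "n' j = n j + 1" using assms(3) a by (auto simp: n'_def)
  ultimately have **: "(\<Sum>k<p. f (n' k)) = f (n j + 1 + a) + (f (n j + 1) + (\<Sum>k\<in>?A. f (n k)))" for f :: "nat \<Rightarrow> nat"
    by simp
  show "(\<Sum>k<p. n' k) = (\<Sum>k<p. n k)" using *[of id] **[of id] a by simp
  show "(\<Sum>k<p. (n' k)\<^sup>2) < (\<Sum>k<p. (n k)\<^sup>2)"
    using *[of "\<lambda>x. x\<^sup>2"] **[of "\<lambda>x. x\<^sup>2"] a by (simp add: power2_eq_square algebra_simps)
qed

text \<open>With \<open>q\<close> the least size, every size is \<open>q\<close> or
  \<open>q + 1\<close>. Hence \<open>q\<close> is the quotient of \<open>m\<close> by
  \<open>p\<close>, the number of large parts is the remainder, and \<open>\<pi>\<close> sends the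
  large parts to the first residues.\<close>

lemma almost_equal_parts:
  fixes n :: "nat \<Rightarrow> nat"
  assumes "(\<Sum>i<p. n i) = m" and close: "\<And>i j. i < p \<Longrightarrow> j < p \<Longrightarrow> n i \<le> n j + 1"
  shows "\<exists>\<pi>. bij_betw \<pi> {..<p} {..<p} \<and> (\<forall>i<p. n i = bal m p (\<pi> i))"
proof (cases "p = 0")
  case True
  then show ?thesis by (auto intro: exI[of _ id])
next
  case False
  then have ne: "n ` {..<p} \<noteq> {}" by auto
  define q where "q = Min (n ` {..<p})"
  obtain k where k: "k < p" "n k = q"
    using Min_in[OF _ ne] unfolding q_def by auto
  have ge: "q \<le> n i" if "i < p" for i unfolding q_def using that by auto
  define A where "A = {i. i < p \<and> n i = q + 1}"
  have n: "n i = q + (if i \<in> A then 1 else 0)" if "i < p" for i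
  proof -
    have "n i \<le> q + 1" using close[OF that k(1)] k(2) by simp
    then show ?thesis using ge[OF that] that unfolding A_def by (cases "n i = q + 1") simp_all
  qed
  have A: "A \<subseteq> {..<p}" "finite A" by (auto simp: A_def)
  \<comment> \<open>The index where the minimum is attained lies outside \<open>A\<close>, so
    \<open>card A < p\<close>, as a remainder modulo \<open>p\<close> must be.\<close>
  have "k \<notin> A" "k \<in> {..<p}" using k by (simp_all add: A_def)
  then have "A \<subset> {..<p}" using A(1) by blast
  then have Ap: "card A < p" using psubset_card_mono[of "{..<p}" A] by simp
  have "m = (\<Sum>i<p. q + (if i \<in> A then 1 else 0))"
    using assms(1) n by simp
  also have "\<dots> = p * q + card A"
    using A(1) by (simp add: sum.distrib sum.If_cases Int_absorb1)
  finally have m: "m = p * q + card A" .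
  then have mm: "m mod p = card A" "m div p = q" using Ap by auto
  obtain f where f: "bij_betw f A {..<card A}"
    using A finite_same_card_bij[of A "{..<card A}"] by auto
  have "card ({..<p} - A) = card ({..<p} - {..<card A})"
    using A Ap by (simp add: card_Diff_subset)
  then obtain g where g: "bij_betw g ({..<p} - A) ({..<p} - {..<card A})"
    using finite_same_card_bij[of "{..<p} - A" "{..<p} - {..<card A}"] by auto
  define \<pi> where "\<pi> i = (if i \<in> A then f i else g i)" for i
  have "bij_betw \<pi> A {..<card A}" using f by (rule bij_betw_cong[THEN iffD1, rotated]) (simp add: \<pi>_def)
  moreover have "bij_betw \<pi> ({..<p} - A) ({..<p} - {..<card A})"
    using g by (rule bij_betw_cong[THEN iffD1, rotated]) (simp add: \<pi>_def)
  ultimately have "bij_betw \<pi> (A \<union> ({..<p} - A)) ({..<card A} \<union> ({..<p} - {..<card A}))"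
    by (rule bij_betw_combine) auto
  moreover have "A \<union> ({..<p} - A) = {..<p}" "{..<card A} \<union> ({..<p} - {..<card A}) = {..<p}"
    using A Ap by auto
  ultimately have b: "bij_betw \<pi> {..<p} {..<p}" by simp
  have "n i = bal m p (\<pi> i)" if "i < p" for i
  proof -
    have "\<pi> i < p" using b that by (auto simp: bij_betw_def)
    moreover have "\<pi> i < card A \<longleftrightarrow> i \<in> A"
      using bij_betwE[OF f] bij_betwE[OF g] that by (fastforce simp: \<pi>_def)
    ultimately show ?thesis using n[OF that] by (simp add: bal_eq mm)
  qed
  with b show ?thesis by blast
qed

text \<open>Induction on the sum of squares. Two sizes differing by at least two admit a shift,
  which raises the coefficient of index \<open>2\<close> strictly and so rules out equality there;
  otherwise the sizes are balanced up to a permutation, which leaves the polynomial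
  unchanged.\<close>

lemma parts_poly_bal:
  fixes n :: "nat \<Rightarrow> nat"
  assumes "(\<Sum>i<p. n i) = m"
  shows "(\<forall>s. coeff (parts_poly n p) s \<le> coeff (parts_poly (bal m p) p) s) \<and>
    (coeff (parts_poly n p) 2 = coeff (parts_poly (bal m p) p) 2 \<longrightarrow>
      (\<exists>\<pi>. bij_betw \<pi> {..<p} {..<p} \<and> (\<forall>i<p. n i = bal m p (\<pi> i))))"
  using assms
proof (induction "\<Sum>k<p. (n k)\<^sup>2" arbitrary: n rule: less_induct)
  case less
  show ?case
  proof (cases "\<exists>i j. i < p \<and> j < p \<and> n j + 2 \<le> n i")
    case True
    then obtain i j where ij: "i < p" "j < p" "n j + 2 \<le> n i" by blast
    then have "i \<noteq> j" by auto
    note shift = parts_poly_shift[OF ij(1,2) this ij(3)]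
    have "(\<Sum>k<p. (n(i := n i - 1, j := n j + 1)) k) = m" using shift(3) less.prems by (simp only:)
    note IH = less.hyps[OF shift(4) this]
    have "coeff (parts_poly n p) s \<le> coeff (parts_poly (bal m p) p) s" for s
      using shift(1)[of s] IH le_trans by blast
    moreover have "coeff (parts_poly n p) 2 < coeff (parts_poly (bal m p) p) 2"
      using shift(2) IH less_le_trans by blast
    ultimately show ?thesis by simp
  next
    case False
    then have "\<And>i j. i < p \<Longrightarrow> j < p \<Longrightarrow> n i \<le> n j + 1" by fastforce
    from almost_equal_parts[OF less.prems this]
    obtain \<pi> where "bij_betw \<pi> {..<p} {..<p}" "\<forall>i<p. n i = bal m p (\<pi> i)" by blast
    then show ?thesis using parts_poly_permute[of \<pi> p n "bal m p"] by auto
  qed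
qed

section \<open>Clique counts\<close>

text \<open>The vertex set is an argument of the notions below rather than a parameter of the
  locale, so that inductions can pass to neighbourhoods and to complements of parts with the same
  relation.\<close>

locale sym_rel =
  fixes E :: "'a \<Rightarrow> 'a \<Rightarrow> bool"
  assumes sym: "E u v \<Longrightarrow> E v u" and irrefl: "\<not> E u u"
begin

definition cliques :: "'a set \<Rightarrow> nat \<Rightarrow> 'a set set" where
  "cliques V s = {R. R \<subseteq> V \<and> card R = s \<and> (\<forall>u\<in>R. \<forall>w\<in>R. u \<noteq> w \<longrightarrow> E u w)}"

definition nbhd :: "'a set \<Rightarrow> 'a \<Rightarrow> 'a set" where
  "nbhd V u = {w \<in> V. E u w}"

text \<open>A complete multipartite graph, not merely a proper colouring. Parts may be empty, so
  \<open>p\<close> only bounds the number of nonempty ones.\<close>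

definition partite :: "'a set \<Rightarrow> ('a \<Rightarrow> nat) \<Rightarrow> nat \<Rightarrow> bool" where
  "partite V c p \<longleftrightarrow> (\<forall>u\<in>V. c u < p) \<and> (\<forall>u\<in>V. \<forall>w\<in>V. E u w \<longleftrightarrow> c u \<noteq> c w)"

lemma finite_cliques [simp]: "finite V \<Longrightarrow> finite (cliques V s)"
  by (rule finite_subset[of _ "Pow V"]) (auto simp: cliques_def)

lemma finite_nbhd [simp]: "finite V \<Longrightarrow> finite (nbhd V u)"
  by (simp add: nbhd_def)

lemma nbhd_subset: "nbhd V u \<subseteq> V"
  by (auto simp: nbhd_def)

lemma cliques_0: "finite V \<Longrightarrow> cliques V 0 = {{}}"
  by (auto simp: cliques_def dest: finite_subset)

lemma cliques_empty: "cliques {} s = (if s = 0 then {{}} else {})"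
  by (auto simp: cliques_def)

lemma cliques_1: "cliques V (Suc 0) = (\<lambda>v. {v}) ` V"
  by (auto simp: cliques_def card_1_singleton_iff)

lemma card_cliques_1: "card (cliques V (Suc 0)) = card V"
  unfolding cliques_1 by (rule card_image) auto

lemma cliques_mono: "V \<subseteq> W \<Longrightarrow> cliques V s \<subseteq> cliques W s"
  by (auto simp: cliques_def)

lemma insert_clique:
  assumes "finite V" "u \<in> V" "R \<in> cliques (nbhd V u) s"
  shows "insert u R \<in> cliques V (Suc s)" "u \<notin> R"
proof -
  have R: "R \<subseteq> nbhd V u" "card R = s" "finite R"
    using assms finite_subset[of R "nbhd V u"] by (auto simp: cliques_def)
  then show u: "u \<notin> R" using irrefl by (auto simp: nbhd_def)
  show "insert u R \<in> cliques V (Suc s)"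
    using assms R u by (auto simp: cliques_def nbhd_def intro: sym)
qed

lemma remove_clique:
  assumes "finite V" "R \<in> cliques V (Suc s)" "u \<in> R"
  shows "R - {u} \<in> cliques (nbhd V u) s"
  using assms by (auto simp: cliques_def nbhd_def dest: finite_subset)

lemma card_insert_cliques:
  assumes "finite V"
  shows "card (insert u ` cliques (nbhd V u) s) = card (cliques (nbhd V u) s)"
proof (rule card_image, rule inj_onI)
  fix R R' assume *: "R \<in> cliques (nbhd V u) s" "R' \<in> cliques (nbhd V u) s" "insert u R = insert u R'"
  then have "u \<notin> R" "u \<notin> R'" using irrefl by (auto simp: cliques_def nbhd_def)
  then show "R = R'" using *(3) by (metis Diff_insert_absorb)
qed

text \<open>A clique that meets \<open>I\<close> is split at one of its vertices in
  \<open>I\<close>. With several such vertices it occurs several times on the right, which is why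
  only an upper bound on the count follows.\<close>

lemma cliques_split:
  assumes "finite V"
  shows "cliques V (Suc s) \<subseteq>
    cliques (V - I) (Suc s) \<union> (\<Union>u\<in>I \<inter> V. insert u ` cliques (nbhd V u) s)"
proof
  fix R assume R: "R \<in> cliques V (Suc s)"
  show "R \<in> cliques (V - I) (Suc s) \<union> (\<Union>u\<in>I \<inter> V. insert u ` cliques (nbhd V u) s)"
  proof (cases "R \<inter> I = {}")
    case True
    then show ?thesis using R by (auto simp: cliques_def)
  next
    case False
    then obtain u where u: "u \<in> R" "u \<in> I" by blast
    then have "u \<in> I \<inter> V" using R by (auto simp: cliques_def)
    moreover have "R = insert u (R - {u})" using u by blast
    ultimately show ?thesis using remove_clique[OF assms R u(1)] by blast
  qed
qed

lemma card_cliques_le: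
  assumes "finite V" "I \<subseteq> V"
  shows "card (cliques V (Suc s)) \<le>
    card (cliques (V - I) (Suc s)) + (\<Sum>u\<in>I. card (cliques (nbhd V u) s))"
proof -
  have fI: "finite I" using assms finite_subset by blast
  have "card (cliques V (Suc s)) \<le>
      card (cliques (V - I) (Suc s) \<union> (\<Union>u\<in>I. insert u ` cliques (nbhd V u) s))"
    using cliques_split[OF assms(1), of s I] assms fI by (intro card_mono) (auto simp: Int_absorb2)
  also have "\<dots> \<le> card (cliques (V - I) (Suc s)) + card (\<Union>u\<in>I. insert u ` cliques (nbhd V u) s)"
    by (rule card_Un_le)
  also have "card (\<Union>u\<in>I. insert u ` cliques (nbhd V u) s) \<le>
      (\<Sum>u\<in>I. card (insert u ` cliques (nbhd V u) s))"
    by (rule card_UN_le[OF fI])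
  finally show ?thesis by (simp add: card_insert_cliques[OF assms(1)])
qed

text \<open>An edge inside \<open>I\<close> is counted from both of its ends, so the bound \<open>card_cliques_le\<close> is strict.\<close>

lemma card_edges_less:
  assumes "finite V" "I \<subseteq> V" and e: "u \<in> I" "w \<in> I" "E u w"
  shows "card (cliques V 2) < card (cliques (V - I) 2) + (\<Sum>u\<in>I. card (nbhd V u))"
proof -
  have fI: "finite I" using assms finite_subset by blast
  \<comment> \<open>The edge between \<open>u\<close> and \<open>w\<close> is deleted from the
    family of \<open>u\<close>; it is still covered by the family of \<open>w\<close>.\<close>
  define B where "B x = (if x = u then insert x ` cliques (nbhd V x) 1 - {{u, w}} else insert x ` cliques (nbhd V x) 1)" for x
  have uw: "u \<noteq> w" using irrefl e by auto
  have "{u} \<in> cliques (nbhd V w) 1" using e(1) sym[OF e(3)] assms(2)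
    by (auto simp: cliques_1 nbhd_def)
  then have "insert w {u} \<in> insert w ` cliques (nbhd V w) 1" by (rule imageI)
  then have wB: "{u, w} \<in> B w" using uw by (simp add: B_def insert_commute)
  have sub: "cliques V 2 \<subseteq> cliques (V - I) 2 \<union> (\<Union>x\<in>I. B x)"
  proof
    fix R assume "R \<in> cliques V 2"
    then have "R \<in> cliques (V - I) 2 \<union> (\<Union>u\<in>I. insert u ` cliques (nbhd V u) 1)"
      using cliques_split[OF assms(1), of 1 I] assms(2) by (auto simp: numeral_2_eq_2 Int_absorb2)
    then consider "R \<in> cliques (V - I) 2" | x where "x \<in> I" "R \<in> insert x ` cliques (nbhd V x) 1"
      by blast
    then show "R \<in> cliques (V - I) 2 \<union> (\<Union>x\<in>I. B x)"
    proof cases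
      case 2
      show ?thesis
      proof (cases "R = {u, w}")
        case True
        then show ?thesis using wB e(2) by (intro UnI2 UN_I) simp_all
      next
        case False
        then have "R \<in> B x" using 2(2) by (cases "x = u") (simp_all add: B_def)
        then show ?thesis using 2(1) by (intro UnI2 UN_I)
      qed
    qed (rule UnI1)
  qed
  have fB: "finite (B x)" for x using assms(1) by (simp add: B_def)
  have cB: "card (B x) \<le> card (nbhd V x)" for x
  proof -
    have "card (B x) \<le> card (insert x ` cliques (nbhd V x) 1)"
      using assms(1) by (intro card_mono) (auto simp: B_def)
    then show ?thesis by (simp add: card_insert_cliques[OF assms(1)] card_cliques_1)
  qed
  have "{u, w} \<in> insert u ` cliques (nbhd V u) 1"
    using e assms(2) by (auto simp: cliques_1 nbhd_def)
  then have "card (B u) < card (insert u ` cliques (nbhd V u) 1)"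
    using assms(1) by (intro psubset_card_mono) (auto simp: B_def)
  then have cu: "card (B u) < card (nbhd V u)"
    by (simp add: card_insert_cliques[OF assms(1)] card_cliques_1)
  have "card (cliques V 2) \<le> card (cliques (V - I) 2 \<union> (\<Union>x\<in>I. B x))"
    using sub fI fB assms(1) by (intro card_mono) auto
  also have "\<dots> \<le> card (cliques (V - I) 2) + card (\<Union>x\<in>I. B x)"
    by (rule card_Un_le)
  also have "card (\<Union>x\<in>I. B x) \<le> (\<Sum>x\<in>I. card (B x))"
    by (rule card_UN_le[OF fI])
  also have "\<dots> < (\<Sum>x\<in>I. card (nbhd V x))"
    using fI cB cu e(1) by (intro sum_strict_mono_ex1) auto
  finally show ?thesis by simp
qed

text \<open>Induction on the number of parts. A clique meets the last part \<open>I\<close> at most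
  once, and each vertex of \<open>I\<close> is joined to everything outside \<open>I\<close>; the
  splitting along \<open>I\<close> is therefore disjoint and matches multiplication by the linear
  factor of \<open>I\<close>.\<close>

lemma partite_card_cliques:
  assumes "finite V" "partite V c p"
  shows "card (cliques V s) = coeff (parts_poly (\<lambda>i. card {u \<in> V. c u = i}) p) s"
  using assms
proof (induction p arbitrary: V s)
  case 0
  then have "V = {}" by (auto simp: partite_def)
  then show ?case by (simp add: cliques_empty parts_poly_def)
next
  case (Suc p)
  show ?case
  proof (cases s)
    case 0
    then show ?thesis using Suc.prems by (simp add: cliques_0)
  next
    case (Suc t)
    define I where "I = {u \<in> V. c u = p}"
    let ?W = "V - I"
    have W: "finite ?W" "partite ?W c p"
      using Suc.prems by (auto simp: partite_def I_def less_Suc_eq)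
    have fI: "finite I" using Suc.prems by (simp add: I_def)
    have nb: "nbhd V u = ?W" if "u \<in> I" for u
      using that Suc.prems(2) by (auto simp: nbhd_def partite_def I_def)
    have IH: "card (cliques ?W r) = coeff (parts_poly (\<lambda>i. card {u \<in> V. c u = i}) p) r" for r
    proof -
      have "parts_poly (\<lambda>i. card {u \<in> ?W. c u = i}) p = parts_poly (\<lambda>i. card {u \<in> V. c u = i}) p"
        unfolding parts_poly_def by (intro prod.cong) (auto simp: I_def intro!: arg_cong[where f = card])
      then show ?thesis using Suc.IH[OF W] by simp
    qed
    have "cliques V (Suc t) = cliques ?W (Suc t) \<union> (\<Union>u\<in>I. insert u ` cliques ?W t)"
    proof
      show "cliques V (Suc t) \<subseteq> cliques ?W (Suc t) \<union> (\<Union>u\<in>I. insert u ` cliques ?W t)"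
        using cliques_split[OF Suc.prems(1), of t I] nb by auto
      have "insert u R \<in> cliques V (Suc t)" if "u \<in> I" "R \<in> cliques ?W t" for u R
        using insert_clique(1)[OF Suc.prems(1), of u R t] nb that by (auto simp: I_def)
      then show "cliques ?W (Suc t) \<union> (\<Union>u\<in>I. insert u ` cliques ?W t) \<subseteq> cliques V (Suc t)"
        using cliques_mono[of ?W V "Suc t"] by auto
    qed
    moreover have "cliques ?W (Suc t) \<inter> (\<Union>u\<in>I. insert u ` cliques ?W t) = {}"
      by (auto simp: cliques_def)
    ultimately have "card (cliques V (Suc t)) =
        card (cliques ?W (Suc t)) + card (\<Union>u\<in>I. insert u ` cliques ?W t)"
      using W fI by (simp add: card_Un_disjoint)
    also have "card (\<Union>u\<in>I. insert u ` cliques ?W t) = (\<Sum>u\<in>I. card (insert u ` cliques ?W t))"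
    proof (rule card_UN_disjoint)
      show "\<forall>u\<in>I. \<forall>w\<in>I. u \<noteq> w \<longrightarrow> insert u ` cliques ?W t \<inter> insert w ` cliques ?W t = {}"
      proof (intro ballI impI equals0I)
        fix u w S assume uw: "u \<in> I" "w \<in> I" "u \<noteq> w"
          and "S \<in> insert u ` cliques ?W t \<inter> insert w ` cliques ?W t"
        then obtain R where "u \<in> S" "S = insert w R" "R \<subseteq> ?W" by (auto simp: cliques_def)
        then show False using uw by auto
      qed
    qed (use fI W in auto)
    also have "\<dots> = card I * card (cliques ?W t)"
    proof -
      have "card (insert u ` cliques ?W t) = card (cliques ?W t)" if "u \<in> I" for u
        using card_insert_cliques[OF Suc.prems(1), of u t] nb[OF that] by simp
      then show ?thesis by simp
    qed
    finally show ?thesis unfolding Suc parts_poly_Suc coeff_linear_mult_Suc IH by (simp add: I_def)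
  qed
qed

text \<open>The induction step of Zykov's theorem: \<open>V\<close> is compared with the complete multipartite graph in
  which the non-neighbours of a vertex of maximum degree form one part and its neighbourhood is
  replaced by a Turan graph. The hypothesis on all \<open>W\<close> is the theorem for \<open>p\<close> parts, proved below.\<close>

lemma max_degree_step:
  assumes V: "finite V"
    and zykov: "\<And>W. finite W \<Longrightarrow> cliques W (Suc p) = {} \<Longrightarrow>
      (\<forall>s. card (cliques W s) \<le> coeff (parts_poly (bal (card W) p) p) s) \<and>
      (card (cliques W 2) = coeff (parts_poly (bal (card W) p) p) 2 \<longrightarrow>
        (\<exists>c. partite W c p \<and> (\<forall>i<p. card {u \<in> W. c u = i} = bal (card W) p i)))"
    and free: "cliques V (Suc (Suc p)) = {}"
    and deg: "\<And>u. u \<in> V \<Longrightarrow> card (nbhd V u) \<le> D"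
    and v: "v \<in> V" "card (nbhd V v) = D"
  defines "n \<equiv> (bal D p)(p := card V - D)"
  shows "(\<forall>s. card (cliques V s) \<le> coeff (parts_poly n (Suc p)) s) \<and>
    (card (cliques V 2) = coeff (parts_poly n (Suc p)) 2 \<longrightarrow>
      (\<exists>c. partite V c (Suc p) \<and> (\<forall>i<Suc p. card {u \<in> V. c u = i} = n i)))"
proof -
  define N where "N = nbhd V v"
  define I where "I = V - N"
  define T where "T = parts_poly (bal D p) p"
  have T: "parts_poly n (Suc p) = [:1, card V - D:] * T"
    unfolding parts_poly_Suc T_def n_def by (simp add: parts_poly_def)
  have NV: "N \<subseteq> V" "V - I = N" using nbhd_subset[of V v] by (auto simp: N_def I_def)
  have fN: "finite N" "card N = D" and fI: "finite I"
    using v V by (auto simp: N_def I_def)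
  have cI: "card I = card V - D"
    unfolding I_def using NV fN card_Diff_subset by metis
  have nfree: "cliques (nbhd V u) (Suc p) = {}" if "u \<in> V" for u
    using insert_clique(1)[OF V that] free by blast
  \<comment> \<open>A neighbourhood may have fewer than \<open>D\<close> vertices. Its balanced part
    sizes are then no larger than those for \<open>D\<close>, so the bound by \<open>T\<close> still
    applies.\<close>
  have Z: "card (cliques (nbhd V u) s) \<le> coeff T s" if "u \<in> V" for u s
  proof -
    have "card (cliques (nbhd V u) s) \<le> coeff (parts_poly (bal (card (nbhd V u)) p) p) s"
      using zykov[OF finite_nbhd[OF V] nfree[OF that]] by blast
    also have "\<dots> \<le> coeff T s"
      unfolding T_def by (intro coeff_parts_poly_mono bal_mono deg that)
    finally show ?thesis .
  qed
  have ZN: "card (cliques N s) \<le> coeff T s" for s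
    unfolding N_def by (rule Z[OF v(1)])
  have le: "card (cliques V s) \<le> coeff (parts_poly n (Suc p)) s" for s
  proof (cases s)
    case 0
    then show ?thesis using V by (simp add: cliques_0)
  next
    case (Suc t)
    have "card (cliques V (Suc t)) \<le> card (cliques N (Suc t)) + (\<Sum>u\<in>I. card (cliques (nbhd V u) t))"
      using card_cliques_le[OF V, of I t] NV by (simp add: I_def)
    also have "\<dots> \<le> coeff T (Suc t) + (\<Sum>u\<in>I. coeff T t)"
      by (intro add_mono sum_mono Z ZN) (auto simp: I_def)
    finally show ?thesis unfolding Suc T coeff_linear_mult_Suc by (simp add: cI)
  qed
  moreover have "\<exists>c. partite V c (Suc p) \<and> (\<forall>i<Suc p. card {u \<in> V. c u = i} = n i)"
    if eq: "card (cliques V 2) = coeff (parts_poly n (Suc p)) 2"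
  proof -
    \<comment> \<open>For \<open>p = 0\<close> there are no parts and the coefficient is
      \<open>0\<close>; clique-freeness then empties \<open>N\<close>, so \<open>D\<close> is
      \<open>0\<close> too.\<close>
    have T1: "coeff T 1 = D" 
    proof (cases "p = 0")
      case True
      then have "cliques N 1 = {}" using nfree[OF v(1)] by (simp add: N_def)
      then have "N = {}" by (simp add: cliques_1)
      then show ?thesis using fN True by (simp add: T_def parts_poly_def)
    qed (simp add: T_def coeff_1_parts_poly sum_bal)
    have eq': "card (cliques V 2) = coeff T 2 + card I * D"
      using eq T1 coeff_linear_mult_Suc[of "card V - D" T 1] unfolding T cI
      by (simp add: numeral_2_eq_2)
    have sumle: "(\<Sum>u\<in>I. card (nbhd V u)) \<le> card I * D"
      using sum_mono[of I "\<lambda>u. card (nbhd V u)" "\<lambda>_. D"] deg by (auto simp: I_def)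
    have IV: "I \<subseteq> V" by (auto simp: I_def)
    have indep: "\<not> E u w" if "u \<in> I" "w \<in> I" for u w
    proof
      assume "E u w"
      from card_edges_less[OF V IV that this] show False
        using eq' sumle ZN[of 2] NV by simp
    qed
    have le2: "card (cliques V 2) \<le> card (cliques N 2) + (\<Sum>u\<in>I. card (nbhd V u))"
      using card_cliques_le[OF V IV, of 1] NV by (simp add: numeral_2_eq_2 card_cliques_1)
    \<comment> \<open>The number of edges attains the sum of two upper bounds, so each of the two is
      attained.\<close>
    then have "card (cliques N 2) = coeff T 2" "(\<Sum>u\<in>I. card (nbhd V u)) = card I * D"
      using eq' sumle ZN[of 2] by linarith+
    \<comment> \<open>Independence of \<open>I\<close> places the neighbourhood inside
      \<open>N\<close>, and a degree below \<open>D\<close> would spoil the attained degree sum;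
      inclusion and equal size give equality.\<close>
    moreover have nbN: "nbhd V u = N" if "u \<in> I" for u
    proof (rule card_subset_eq[OF fN(1)])
      show "nbhd V u \<subseteq> N" using indep[OF that] by (auto simp: nbhd_def I_def)
      show "card (nbhd V u) = card N"
      proof (rule ccontr)
        assume "card (nbhd V u) \<noteq> card N"
        then have "card (nbhd V u) < D" using deg[of u] that IV fN by force
        then have "(\<Sum>u\<in>I. card (nbhd V u)) < (\<Sum>u\<in>I. D)"
          using that deg IV fI by (intro sum_strict_mono_ex1) auto
        then show False using \<open>(\<Sum>u\<in>I. card (nbhd V u)) = card I * D\<close> by simp
      qed
    qed
    ultimately obtain c where c: "partite N c p" "\<forall>i<p. card {u \<in> N. c u = i} = bal D p i"
      using zykov[OF fN(1)] nfree[OF v(1)] fN(2) unfolding N_def[symmetric] T_def by blast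
    define c' where "c' u = (if u \<in> N then c u else p)" for u
    have EN: "E u w \<longleftrightarrow> c u \<noteq> c w" "c u < p" if "u \<in> N" "w \<in> N" for u w
      using c(1) that by (auto simp: partite_def)
    have EI: "E u w" "E w u" if "u \<in> I" "w \<in> N" for u w
      using nbN[OF that(1)] that(2) sym by (auto simp: nbhd_def)
    have "E u w \<longleftrightarrow> c' u \<noteq> c' w" if "u \<in> V" "w \<in> V" for u w
      using that indep[of u w] EN[of u w] EI[of u w] EI[of w u] EN(2)[of u u] EN(2)[of w w]
      by (cases "u \<in> N"; cases "w \<in> N") (auto simp: c'_def I_def)
    then have "partite V c' (Suc p)"
      using EN(2) by (auto simp: partite_def c'_def less_Suc_eq)
    moreover have "card {u \<in> V. c' u = i} = n i" if "i < Suc p" for i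
    proof (cases "i = p")
      case True
      then have "{u \<in> V. c' u = i} = I" using EN(2) by (auto simp: c'_def I_def)
      then show ?thesis using True cI by (simp add: n_def)
    next
      case False
      then have "{u \<in> V. c' u = i} = {u \<in> N. c u = i}" using NV by (auto simp: c'_def)
      then show ?thesis using False that c(2) by (simp add: n_def)
    qed
    ultimately show ?thesis by blast
  qed
  ultimately show ?thesis by blast
qed

text \<open>Induction on \<open>p\<close>: a vertex of maximum degree bounds all clique counts by
  those of a complete multipartite graph with \<open>Suc p\<close> parts, and balancing its sizes
  can only increase them.\<close>

theorem zykov_turan:
  assumes "finite V" "cliques V (Suc p) = {}"
  shows "(\<forall>s. card (cliques V s) \<le> coeff (parts_poly (bal (card V) p) p) s) \<and>
    (card (cliques V 2) = coeff (parts_poly (bal (card V) p) p) 2 \<longrightarrow>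
      (\<exists>c. partite V c p \<and> (\<forall>i<p. card {u \<in> V. c u = i} = bal (card V) p i)))"
  using assms
proof (induction p arbitrary: V)
  case 0
  then have "V = {}" by (simp add: cliques_1)
  then have "card (cliques V s) \<le> coeff (parts_poly (bal (card V) 0) 0) s" for s
    by (simp add: cliques_empty)
  with \<open>V = {}\<close> show ?case by (auto simp: partite_def)
next
  case (Suc p)
  show ?case
  proof (cases "V = {}")
    case True
    then have "card (cliques V s) \<le> coeff (parts_poly (bal (card V) (Suc p)) (Suc p)) s" for s
      by (simp add: cliques_empty)
    moreover have "\<exists>c. partite V c (Suc p) \<and> (\<forall>i<Suc p. card {u \<in> V. c u = i} = bal (card V) (Suc p) i)"
      using True by (simp add: partite_def bal_def)
    ultimately show ?thesis by blast
  next
    case False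
    define D where "D = Max (card ` nbhd V ` V)"
    have "D \<in> card ` nbhd V ` V" unfolding D_def using False Suc.prems by (intro Max_in) auto
    then obtain v where v: "v \<in> V" "card (nbhd V v) = D" by auto
    have deg: "card (nbhd V u) \<le> D" if "u \<in> V" for u
      unfolding D_def using that Suc.prems by (intro Max_ge) auto
    define n where "n = (bal D p)(p := card V - D)"
    note step = max_degree_step[OF Suc.prems(1) Suc.IH Suc.prems(2) deg v, folded n_def]
    have "D \<le> card V" using v card_mono[OF Suc.prems(1) nbhd_subset] by metis
    moreover have "(\<Sum>i<p. bal D p i) = D"
    proof (cases "p = 0")
      case True
      then have "nbhd V v = {}" using insert_clique(1)[OF Suc.prems(1) v(1), of _ 1] Suc.prems(2)
        by (auto simp: cliques_1)
      then show ?thesis using v True by simp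
    qed (simp add: sum_bal)
    ultimately have "(\<Sum>i<Suc p. n i) = card V" by (simp add: n_def)
    note bal = parts_poly_bal[OF this]
    have "card (cliques V s) \<le> coeff (parts_poly (bal (card V) (Suc p)) (Suc p)) s" for s
      using step bal le_trans by blast
    moreover have "\<exists>c. partite V c (Suc p) \<and> (\<forall>i<Suc p. card {u \<in> V. c u = i} = bal (card V) (Suc p) i)"
      if "card (cliques V 2) = coeff (parts_poly (bal (card V) (Suc p)) (Suc p)) 2"
    proof -
      \<comment> \<open>Equality between the ends of the two-step estimate makes both steps
        equalities.\<close>
      have "card (cliques V 2) = coeff (parts_poly n (Suc p)) 2"
        "coeff (parts_poly n (Suc p)) 2 = coeff (parts_poly (bal (card V) (Suc p)) (Suc p)) 2"
        using step bal that by (metis le_antisym)+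
      then obtain c \<pi> where c: "partite V c (Suc p)" "\<And>i. i < Suc p \<Longrightarrow> card {u \<in> V. c u = i} = n i"
        and \<pi>: "bij_betw \<pi> {..<Suc p} {..<Suc p}" "\<And>i. i < Suc p \<Longrightarrow> n i = bal (card V) (Suc p) (\<pi> i)"
        using step bal by blast
      have cV: "c u < Suc p" if "u \<in> V" for u using c(1) that by (auto simp: partite_def)
      have inj: "\<pi> i = \<pi> j \<longleftrightarrow> i = j" if "i < Suc p" "j < Suc p" for i j
        using \<pi>(1) that by (auto simp: bij_betw_def inj_on_def)
      \<comment> \<open>The permutation renames the colours so that each one has exactly the size
        that \<open>bal\<close> assigns to it.\<close>
      have "partite V (\<pi> \<circ> c) (Suc p)"
        unfolding partite_def
      proof (intro conjI ballI)
        fix u assume u: "u \<in> V"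
        show "(\<pi> \<circ> c) u < Suc p" using bij_betwE[OF \<pi>(1)] cV[OF u] by simp
        fix w assume w: "w \<in> V"
        show "E u w \<longleftrightarrow> (\<pi> \<circ> c) u \<noteq> (\<pi> \<circ> c) w"
          using c(1) u w inj[OF cV[OF u] cV[OF w]] by (simp add: partite_def)
      qed
      moreover have "card {u \<in> V. (\<pi> \<circ> c) u = i} = bal (card V) (Suc p) i" if i: "i < Suc p" for i
      proof -
        have "i \<in> \<pi> ` {..<Suc p}" using bij_betw_imp_surj_on[OF \<pi>(1)] i by simp
        then obtain j where j: "j < Suc p" "\<pi> j = i" by auto
        have "(\<pi> \<circ> c) u = i \<longleftrightarrow> c u = j" if "u \<in> V" for u
          using j(2) inj[OF cV[OF that] j(1)] by simp
        then have "{u \<in> V. (\<pi> \<circ> c) u = i} = {u \<in> V. c u = j}" by blast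
        then show ?thesis using c(2) \<pi>(2) j by simp
      qed
      ultimately show ?thesis by blast
    qed
    ultimately show ?thesis by blast
  qed
qed

end

section \<open>Clique counts and eigenvectors\<close>

text \<open>Repeated multiplication by \<open>\<rho>\<close>, each time replacing
  \<open>\<rho> * f t\<close> by its bound. In the application \<open>f t\<close> is the weight of
  the \<open>Suc t\<close>-cliques, so the last summand vanishes once such cliques are
  absent.\<close>

lemma telescope_power_le:
  fixes f a :: "nat \<Rightarrow> real"
  assumes "\<rho> \<ge> 0" "\<And>t. \<rho> * f t \<le> a t + f (Suc t)"
  shows "\<rho> ^ t * f 0 \<le> (\<Sum>s<t. a s * \<rho> ^ (t - Suc s)) + f t"
proof (induction t)
  case (Suc t)
  have "\<rho> ^ Suc t * f 0 = \<rho> * (\<rho> ^ t * f 0)" by simp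
  also have "\<dots> \<le> \<rho> * ((\<Sum>s<t. a s * \<rho> ^ (t - Suc s)) + f t)"
    using Suc assms(1) by (rule mult_left_mono)
  also have "\<dots> = (\<Sum>s<t. a s * \<rho> ^ (Suc t - Suc s)) + \<rho> * f t"
  proof -
    have "\<rho> * (a s * \<rho> ^ (t - Suc s)) = a s * \<rho> ^ (Suc t - Suc s)" if "s < t" for s
    proof -
      have "Suc t - Suc s = Suc (t - Suc s)" using that by simp
      then show ?thesis by (simp only: power_Suc mult.left_commute)
    qed
    then have "(\<Sum>s<t. \<rho> * (a s * \<rho> ^ (t - Suc s))) = (\<Sum>s<t. a s * \<rho> ^ (Suc t - Suc s))"
      by (intro sum.cong) (simp_all only: lessThan_iff)
    then show ?thesis by (simp only: distrib_left sum_distrib_left)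
  qed
  also have "\<dots> \<le> (\<Sum>s<t. a s * \<rho> ^ (Suc t - Suc s)) + (a t + f (Suc t))"
    using assms(2)[of t] by simp
  finally show ?case by simp
qed simp

text \<open>The inequality is applied to \<open>f\<close> and \<open>a\<close>, and again to their
  negatives.\<close>

lemma telescope_power_eq:
  fixes f a :: "nat \<Rightarrow> real"
  assumes "\<rho> \<ge> 0" "\<And>t. \<rho> * f t = a t + f (Suc t)"
  shows "\<rho> ^ t * f 0 = (\<Sum>s<t. a s * \<rho> ^ (t - Suc s)) + f t"
proof (rule antisym)
  show "\<rho> ^ t * f 0 \<le> (\<Sum>s<t. a s * \<rho> ^ (t - Suc s)) + f t"
    using telescope_power_le[of \<rho> f a t] assms by simp
  have "\<rho> ^ t * (- f 0) \<le> (\<Sum>s<t. (- a s) * \<rho> ^ (t - Suc s)) + (- f t)"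
    using telescope_power_le[of \<rho> "\<lambda>s. - f s" "\<lambda>s. - a s" t] assms by simp
  then show "(\<Sum>s<t. a s * \<rho> ^ (t - Suc s)) + f t \<le> \<rho> ^ t * f 0"
    by (simp add: sum_negf)
qed

text \<open>After division by \<open>\<rho> ^ r\<close> the sum with coefficients \<open>b\<close>
  has terms \<open>s * b s / \<rho> ^ (s + 1)\<close>; it strictly decreases in
  \<open>\<rho>\<close> and equals \<open>1\<close> at \<open>\<kappa>\<close>, which excludes
  \<open>\<rho> > \<kappa>\<close>. The proof cross-multiplies instead of dividing. In the
  application index \<open>s\<close> belongs to the \<open>Suc s\<close>-cliques, so index
  \<open>1\<close> counts edges.\<close>

lemma compare_roots:
  fixes a b :: "nat \<Rightarrow> real"
  assumes \<rho>: "\<rho> \<ge> 0" "\<rho> ^ r \<le> (\<Sum>s<r. real s * a s * \<rho> ^ (r - Suc s))"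
    and \<kappa>: "\<kappa> > 0" "\<kappa> ^ r = (\<Sum>s<r. real s * b s * \<kappa> ^ (r - Suc s))"
    and ab: "\<And>s. s < r \<Longrightarrow> a s \<le> b s" "\<And>s. b s \<ge> 0" "b 1 > 0" and r: "r \<ge> 2"
  shows "\<rho> \<le> \<kappa> \<and> (\<rho> = \<kappa> \<longrightarrow> a 1 = b 1)"
proof
  show "\<rho> \<le> \<kappa>"
  proof (rule ccontr)
    assume "\<not> \<rho> \<le> \<kappa>"
    then have lt: "\<kappa> < \<rho>" by simp
    have "\<rho> ^ r * \<kappa> ^ r \<le> (\<Sum>s<r. real s * b s * \<rho> ^ (r - Suc s)) * \<kappa> ^ r"
    proof (rule mult_right_mono)
      have "(\<Sum>s<r. real s * a s * \<rho> ^ (r - Suc s)) \<le> (\<Sum>s<r. real s * b s * \<rho> ^ (r - Suc s))"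
        using ab(1) \<rho>(1) by (intro sum_mono mult_right_mono mult_left_mono) auto
      then show "\<rho> ^ r \<le> (\<Sum>s<r. real s * b s * \<rho> ^ (r - Suc s))" using \<rho>(2) by simp
    qed (use \<kappa>(1) in simp)
    also have "\<dots> = (\<Sum>s<r. (real s * b s) * (\<rho> ^ (r - Suc s) * \<kappa> ^ r))"
      by (simp only: sum_distrib_right mult.assoc)
    also have "\<dots> < (\<Sum>s<r. (real s * b s) * (\<kappa> ^ (r - Suc s) * \<rho> ^ r))"
    proof (rule sum_strict_mono_ex1)
      have less: "\<rho> ^ (r - Suc s) * \<kappa> ^ r < \<kappa> ^ (r - Suc s) * \<rho> ^ r" if "s < r" for s
      proof -
        have r: "x ^ r = x ^ (r - Suc s) * x ^ Suc s" for x :: real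
          using that by (metis Suc_leI le_add_diff_inverse2 power_add)
        have "\<kappa> ^ Suc s < \<rho> ^ Suc s" using lt \<kappa>(1) by (intro power_strict_mono) auto
        then have "\<rho> ^ (r - Suc s) * \<kappa> ^ (r - Suc s) * \<kappa> ^ Suc s < \<rho> ^ (r - Suc s) * \<kappa> ^ (r - Suc s) * \<rho> ^ Suc s"
          using lt \<kappa>(1) by (intro mult_strict_left_mono) auto
        then show ?thesis unfolding r by (simp only: mult_ac)
      qed
      then show "\<forall>s\<in>{..<r}. (real s * b s) * (\<rho> ^ (r - Suc s) * \<kappa> ^ r) \<le> (real s * b s) * (\<kappa> ^ (r - Suc s) * \<rho> ^ r)"
        using ab(2) mult_left_mono[OF less_imp_le[OF less]] by simp
      \<comment> \<open>Strictness comes from \<open>s = 1\<close>, where the factor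
        \<open>b 1\<close> is positive; the term \<open>s = 0\<close> has factor
        \<open>0\<close>.\<close>
      show "\<exists>s\<in>{..<r}. (real s * b s) * (\<rho> ^ (r - Suc s) * \<kappa> ^ r) < (real s * b s) * (\<kappa> ^ (r - Suc s) * \<rho> ^ r)"
        using mult_strict_left_mono[OF less[of 1], of "real 1 * b 1"] ab(3) r
        by (intro bexI[of _ 1]) simp_all
    qed simp
    also have "\<dots> = (\<Sum>s<r. real s * b s * \<kappa> ^ (r - Suc s)) * \<rho> ^ r"
      unfolding sum_distrib_right by (simp only: mult.assoc)
    also have "\<dots> = \<kappa> ^ r * \<rho> ^ r" unfolding \<kappa>(2)[symmetric] ..
    finally have "\<kappa> ^ r * \<rho> ^ r < \<kappa> ^ r * \<rho> ^ r" by (simp only: mult.commute)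
    then show False by (rule less_irrefl[THEN notE])
  qed
  show "\<rho> = \<kappa> \<longrightarrow> a 1 = b 1"
  proof
    assume eq: "\<rho> = \<kappa>"
    show "a 1 = b 1"
    proof (rule ccontr)
      assume "a 1 \<noteq> b 1"
      then have lt: "a 1 < b 1" using ab(1)[of 1] r by simp
      have "(\<Sum>s<r. real s * a s * \<kappa> ^ (r - Suc s)) < (\<Sum>s<r. real s * b s * \<kappa> ^ (r - Suc s))"
      proof (rule sum_strict_mono_ex1)
        show "\<forall>s\<in>{..<r}. real s * a s * \<kappa> ^ (r - Suc s) \<le> real s * b s * \<kappa> ^ (r - Suc s)"
          using ab(1) \<kappa>(1) by (auto intro!: mult_right_mono mult_left_mono)
        show "\<exists>s\<in>{..<r}. real s * a s * \<kappa> ^ (r - Suc s) < real s * b s * \<kappa> ^ (r - Suc s)"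
          by (rule bexI[of _ 1]) (use lt r \<kappa>(1) in auto)
      qed simp
      then show False using \<rho>(2) \<kappa>(2) eq by simp
    qed
  qed
qed

context sym_rel
begin

definition clique_weight :: "'a set \<Rightarrow> ('a \<Rightarrow> real) \<Rightarrow> nat \<Rightarrow> real" where
  "clique_weight V y s = (\<Sum>R\<in>cliques V s. \<Sum>u\<in>R. y u)"

text \<open>Sum the eigenvalue equation over the vertices of all \<open>s\<close>-cliques. A vertex is adjacent to at most
  \<open>s - 1\<close> vertices of an \<open>s\<close>-clique unless it extends the clique, and in a complete multipartite
  graph to at least \<open>s - 1\<close>; hence the recursion for \<open>clique_weight\<close>, an identity in that case.\<close>

definition extensions :: "'a set \<Rightarrow> 'a set \<Rightarrow> 'a set" where
  "extensions V R = {w \<in> V. w \<notin> R \<and> (\<forall>u\<in>R. E u w)}"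

section \<open>The recursion for weighted clique sums\<close>

lemma clique_weight_1: "clique_weight V y (Suc 0) = (\<Sum>v\<in>V. y v)"
  unfolding clique_weight_def cliques_1 by (subst sum.reindex) auto

text \<open>Double counting of the adjacent pairs with first vertex in \<open>R\<close>.\<close>

lemma sum_nbhd_clique:
  assumes "finite V" "R \<subseteq> V"
  shows "(\<Sum>u\<in>R. \<Sum>w\<in>nbhd V u. y w) = (\<Sum>w\<in>V. real (card (R \<inter> nbhd V w)) * y w)"
proof -
  have fR: "finite R" using assms finite_subset by blast
  have "(\<Sum>u\<in>R. \<Sum>w\<in>nbhd V u. y w) = (\<Sum>u\<in>R. \<Sum>w\<in>V. if E u w then y w else 0)"
    unfolding nbhd_def by (simp only: sum.inter_filter[OF assms(1)])
  also have "\<dots> = (\<Sum>w\<in>V. \<Sum>u\<in>R. if E u w then y w else 0)"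
    by (rule sum.swap)
  also have "\<dots> = (\<Sum>w\<in>V. real (card (R \<inter> nbhd V w)) * y w)"
  proof (rule sum.cong[OF refl])
    fix w
    have "(\<Sum>u\<in>R. if E u w then y w else 0) = (\<Sum>u\<in>{u \<in> R. E u w}. y w)"
      by (rule sum.inter_filter[OF fR, symmetric])
    also have "{u \<in> R. E u w} = R \<inter> nbhd V w"
      using assms(2) sym by (auto simp: nbhd_def)
    finally show "(\<Sum>u\<in>R. if E u w then y w else 0) = real (card (R \<inter> nbhd V w)) * y w" by simp
  qed
  finally show ?thesis .
qed

text \<open>A member of \<open>R\<close> is not adjacent to itself, and a vertex outside
  \<open>R\<close> that is no extension misses some member; either way at least one of the
  \<open>Suc t\<close> members is lost.\<close>

lemma card_clique_nbhd_le:
  assumes "finite V" "R \<in> cliques V (Suc t)" "w \<in> V"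
  shows "card (R \<inter> nbhd V w) \<le> t + of_bool (w \<in> extensions V R)"
proof -
  have R: "R \<subseteq> V" "card R = Suc t" "finite R"
    using assms finite_subset by (auto simp: cliques_def)
  show ?thesis
  proof (cases "w \<in> extensions V R")
    case True
    then show ?thesis using R card_mono[of R "R \<inter> nbhd V w"] by auto
  next
    case False
    then have "\<exists>u\<in>R. \<not> E w u"
      using assms(3) irrefl sym by (auto simp: extensions_def)
    then have "R \<inter> nbhd V w \<subset> R" by (auto simp: nbhd_def)
    then have "card (R \<inter> nbhd V w) < card R" by (rule psubset_card_mono[OF R(3)])
    then show ?thesis using R(2) by simp
  qed
qed

text \<open>The members of \<open>R\<close> not adjacent to \<open>w\<close> all lie in the part of
  \<open>w\<close>, and a clique has at most one vertex in a part.\<close>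

lemma card_clique_nbhd_partite:
  assumes "finite V" "partite V c p" "R \<in> cliques V (Suc t)" "w \<in> V"
  shows "card (R \<inter> nbhd V w) = t + of_bool (w \<in> extensions V R)"
proof -
  have R: "R \<subseteq> V" "card R = Suc t" "finite R"
    using assms finite_subset by (auto simp: cliques_def)
  have adj: "E u v \<longleftrightarrow> c u \<noteq> c v" if "u \<in> V" "v \<in> V" for u v
    using assms(2) that by (auto simp: partite_def)
  show ?thesis
  proof (cases "w \<in> extensions V R")
    case True
    then have "R \<inter> nbhd V w = R" using R(1) sym by (auto simp: extensions_def nbhd_def)
    then show ?thesis using R True by simp
  next
    case False
    have "u = v" if "u \<in> R - nbhd V w" "v \<in> R - nbhd V w" for u v
    proof (rule ccontr)
      assume "u \<noteq> v"
      then have "E u v" using that assms(3) by (auto simp: cliques_def)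
      moreover have "c u = c w" "c v = c w"
        using that R(1) adj[OF assms(4)] by (auto simp: nbhd_def)
      ultimately show False using adj[of u v] that R(1) by auto
    qed
    then have "card (R - nbhd V w) \<le> 1"
      using R(3) by (simp add: card_le_Suc0_iff_eq)
    moreover have "card R = card (R \<inter> nbhd V w) + card (R - nbhd V w)"
      using R(3) card_Int_Diff by blast
    ultimately have "t \<le> card (R \<inter> nbhd V w)" using R(2) by simp
    then show ?thesis using card_clique_nbhd_le[OF assms(1,3,4)] False by simp
  qed
qed

text \<open>An \<open>s\<close>-clique with an extending vertex is the same as a
  \<open>Suc s\<close>-clique with a marked vertex.\<close>

lemma sum_extensions:
  assumes "finite V"
  shows "(\<Sum>R\<in>cliques V s. \<Sum>w\<in>extensions V R. y w) = clique_weight V y (Suc s)"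
proof -
  have fin: "finite (extensions V R)" for R using assms by (simp add: extensions_def)
  have finR: "finite R" if "R \<in> cliques V t" for R t
    using that assms finite_subset by (auto simp: cliques_def)
  have "(\<Sum>R\<in>cliques V s. \<Sum>w\<in>extensions V R. y w) =
      (\<Sum>(R, w)\<in>Sigma (cliques V s) (extensions V). y w)"
    using assms fin by (intro sum.Sigma) auto
  also have "\<dots> = (\<Sum>(R, w)\<in>Sigma (cliques V (Suc s)) (\<lambda>R. R). y w)"
  proof (rule sum.reindex_bij_witness[where i = "\<lambda>(R, w). (R - {w}, w)" and j = "\<lambda>(R, w). (insert w R, w)"])
    fix a assume a: "a \<in> Sigma (cliques V (Suc s)) (\<lambda>R. R)"
    then obtain R w where Rw: "a = (R, w)" "R \<in> cliques V (Suc s)" "w \<in> R" by auto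
    then show "(case case a of (R, w) \<Rightarrow> (R - {w}, w) of (R, w) \<Rightarrow> (insert w R, w)) = a" by auto
    show "(case a of (R, w) \<Rightarrow> (R - {w}, w)) \<in> Sigma (cliques V s) (extensions V)"
      using Rw finR[OF Rw(2)] by (auto simp: cliques_def extensions_def)
  next
    fix a assume a: "a \<in> Sigma (cliques V s) (extensions V)"
    then obtain R w where Rw: "a = (R, w)" "R \<in> cliques V s" "w \<in> extensions V R" by auto
    then show "(case case a of (R, w) \<Rightarrow> (insert w R, w) of (R, w) \<Rightarrow> (R - {w}, w)) = a"
      by (auto simp: extensions_def)
    show "(case a of (R, w) \<Rightarrow> (insert w R, w)) \<in> Sigma (cliques V (Suc s)) (\<lambda>R. R)"
      using Rw finR[OF Rw(2)] sym by (auto simp: cliques_def extensions_def)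
    show "(case case a of (R, w) \<Rightarrow> (insert w R, w) of (R, w) \<Rightarrow> y w) = (case a of (R, w) \<Rightarrow> y w)"
      using Rw by simp
  qed
  also have "\<dots> = clique_weight V y (Suc s)"
    unfolding clique_weight_def using assms finR by (intro sum.Sigma[symmetric]) auto
  finally show ?thesis .
qed

lemma sum_of_bool_extensions:
  assumes "finite V"
  shows "(\<Sum>w\<in>V. real (t + of_bool (w \<in> extensions V R)) * y w) =
    real t * (\<Sum>w\<in>V. y w) + (\<Sum>w\<in>extensions V R. y w)"
proof -
  have "(\<Sum>w\<in>V. of_bool (w \<in> extensions V R) * y w) = (\<Sum>w\<in>V. if w \<in> extensions V R then y w else 0)"
    by (rule sum.cong) auto
  also have "\<dots> = (\<Sum>w\<in>extensions V R. y w)"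
    using assms by (subst sum.inter_restrict[symmetric]) (auto simp: extensions_def intro!: sum.cong)
  finally show ?thesis by (simp add: distrib_right sum.distrib sum_distrib_left)
qed

lemma clique_weight_step_le:
  assumes "finite V" "\<And>v. v \<in> V \<Longrightarrow> y v \<ge> 0"
    and "\<And>v. v \<in> V \<Longrightarrow> \<rho> * y v \<le> (\<Sum>w\<in>nbhd V v. y w)"
  shows "\<rho> * clique_weight V y (Suc t) \<le>
    real t * real (card (cliques V (Suc t))) * (\<Sum>v\<in>V. y v) + clique_weight V y (Suc (Suc t))"
proof -
  have "\<rho> * clique_weight V y (Suc t) = (\<Sum>R\<in>cliques V (Suc t). \<Sum>u\<in>R. \<rho> * y u)"
    by (simp add: clique_weight_def sum_distrib_left)
  also have "\<dots> \<le> (\<Sum>R\<in>cliques V (Suc t). real t * (\<Sum>w\<in>V. y w) + (\<Sum>w\<in>extensions V R. y w))"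
  proof (rule sum_mono)
    fix R assume R: "R \<in> cliques V (Suc t)"
    then have RV: "R \<subseteq> V" by (auto simp: cliques_def)
    have "(\<Sum>u\<in>R. \<rho> * y u) \<le> (\<Sum>u\<in>R. \<Sum>w\<in>nbhd V u. y w)"
      using RV assms(3) by (intro sum_mono) auto
    also have "\<dots> = (\<Sum>w\<in>V. real (card (R \<inter> nbhd V w)) * y w)"
      by (rule sum_nbhd_clique[OF assms(1) RV])
    also have "\<dots> \<le> (\<Sum>w\<in>V. real (t + of_bool (w \<in> extensions V R)) * y w)"
      by (intro sum_mono mult_right_mono assms(2) of_nat_mono card_clique_nbhd_le[OF assms(1) R])
    finally show "(\<Sum>u\<in>R. \<rho> * y u) \<le> real t * (\<Sum>w\<in>V. y w) + (\<Sum>w\<in>extensions V R. y w)"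
      by (simp only: sum_of_bool_extensions[OF assms(1)])
  qed
  also have "\<dots> = real t * real (card (cliques V (Suc t))) * (\<Sum>v\<in>V. y v) + clique_weight V y (Suc (Suc t))"
    by (simp add: sum.distrib sum_extensions[OF assms(1)])
  finally show ?thesis .
qed

lemma clique_weight_step_partite:
  assumes "finite V" "partite V c p"
    and "\<And>v. v \<in> V \<Longrightarrow> \<rho> * y v = (\<Sum>w\<in>nbhd V v. y w)"
  shows "\<rho> * clique_weight V y (Suc t) =
    real t * real (card (cliques V (Suc t))) * (\<Sum>v\<in>V. y v) + clique_weight V y (Suc (Suc t))"
proof -
  have "\<rho> * clique_weight V y (Suc t) = (\<Sum>R\<in>cliques V (Suc t). \<Sum>u\<in>R. \<rho> * y u)"
    by (simp add: clique_weight_def sum_distrib_left)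
  also have "\<dots> = (\<Sum>R\<in>cliques V (Suc t). real t * (\<Sum>w\<in>V. y w) + (\<Sum>w\<in>extensions V R. y w))"
  proof (rule sum.cong[OF refl])
    fix R assume R: "R \<in> cliques V (Suc t)"
    then have RV: "R \<subseteq> V" by (auto simp: cliques_def)
    have "(\<Sum>u\<in>R. \<rho> * y u) = (\<Sum>u\<in>R. \<Sum>w\<in>nbhd V u. y w)"
      using RV assms(3) by (intro sum.cong) auto
    also have "\<dots> = (\<Sum>w\<in>V. real (card (R \<inter> nbhd V w)) * y w)"
      by (rule sum_nbhd_clique[OF assms(1) RV])
    also have "\<dots> = (\<Sum>w\<in>V. real (t + of_bool (w \<in> extensions V R)) * y w)"
      using card_clique_nbhd_partite[OF assms(1,2) R] by (intro sum.cong) auto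
    finally show "(\<Sum>u\<in>R. \<rho> * y u) = real t * (\<Sum>w\<in>V. y w) + (\<Sum>w\<in>extensions V R. y w)"
      by (simp only: sum_of_bool_extensions[OF assms(1)])
  qed
  also have "\<dots> = real t * real (card (cliques V (Suc t))) * (\<Sum>v\<in>V. y v) + clique_weight V y (Suc (Suc t))"
    by (simp add: sum.distrib sum_extensions[OF assms(1)])
  finally show ?thesis .
qed

text \<open>The Bollobas--Nikiforov inequality with its index shifted by one. The telescope starts
  at the weight of single vertices, the sum of \<open>y\<close>, and ends at the absent
  \<open>Suc r\<close>-cliques; the positive sum of \<open>y\<close> cancels. The eigenvalue
  condition is an inequality because \<open>y\<close> will consist of moduli of a complex
  eigenvector.\<close>

lemma spectral_clique_bound:
  assumes "finite V" "\<And>v. v \<in> V \<Longrightarrow> y v \<ge> 0" "(\<Sum>v\<in>V. y v) > 0" "\<rho> \<ge> 0"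
    and "\<And>v. v \<in> V \<Longrightarrow> \<rho> * y v \<le> (\<Sum>w\<in>nbhd V v. y w)"
    and "cliques V (Suc r) = {}"
  shows "\<rho> ^ r \<le> (\<Sum>s<r. real s * real (card (cliques V (Suc s))) * \<rho> ^ (r - Suc s))"
proof -
  define F where "F = (\<Sum>v\<in>V. y v)"
  have "\<rho> ^ r * F \<le> (\<Sum>s<r. (real s * real (card (cliques V (Suc s))) * F) * \<rho> ^ (r - Suc s))"
    using telescope_power_le[of \<rho> "\<lambda>t. clique_weight V y (Suc t)"
        "\<lambda>t. real t * real (card (cliques V (Suc t))) * F" r]
      clique_weight_step_le[OF assms(1,2,5)] assms(4)
    by (simp add: clique_weight_1 F_def[symmetric]) (simp add: clique_weight_def assms(6))
  also have "\<dots> = (\<Sum>s<r. real s * real (card (cliques V (Suc s))) * \<rho> ^ (r - Suc s)) * F"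
    unfolding sum_distrib_right by (simp only: mult_ac)
  finally show ?thesis using assms(3) unfolding F_def[symmetric] by simp
qed

lemma spectral_clique_partite:
  assumes "finite V" "partite V c p" "(\<Sum>v\<in>V. y v) > 0" "\<rho> \<ge> 0"
    and "\<And>v. v \<in> V \<Longrightarrow> \<rho> * y v = (\<Sum>w\<in>nbhd V v. y w)"
    and "cliques V (Suc r) = {}"
  shows "\<rho> ^ r = (\<Sum>s<r. real s * real (card (cliques V (Suc s))) * \<rho> ^ (r - Suc s))"
proof -
  define F where "F = (\<Sum>v\<in>V. y v)"
  have "\<rho> ^ r * F = (\<Sum>s<r. (real s * real (card (cliques V (Suc s))) * F) * \<rho> ^ (r - Suc s))"
    using telescope_power_eq[of \<rho> "\<lambda>t. clique_weight V y (Suc t)"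
        "\<lambda>t. real t * real (card (cliques V (Suc t))) * F" r]
      clique_weight_step_partite[OF assms(1,2,5)] assms(4)
    by (simp add: clique_weight_1 F_def[symmetric]) (simp add: clique_weight_def assms(6))
  also have "\<dots> = (\<Sum>s<r. real s * real (card (cliques V (Suc s))) * \<rho> ^ (r - Suc s)) * F"
    unfolding sum_distrib_right by (simp only: mult_ac)
  finally show ?thesis using assms(3) unfolding F_def[symmetric] by simp
qed

lemma partite_no_large_clique:
  assumes "finite V" "partite V c p"
  shows "cliques V (Suc p) = {}"
proof (rule equals0I)
  fix R assume R: "R \<in> cliques V (Suc p)"
  then have RV: "R \<subseteq> V" by (simp add: cliques_def)
  have "c u \<noteq> c w" if "u \<in> R" "w \<in> R" "u \<noteq> w" for u w
  proof -
    have "E u w" using R that by (simp add: cliques_def)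
    moreover have "u \<in> V" "w \<in> V" using RV that by auto
    ultimately show ?thesis using assms(2) by (simp add: partite_def)
  qed
  then have "inj_on c R" by (meson inj_onI)
  moreover have "c ` R \<subseteq> {..<p}" using assms(2) RV by (auto simp: partite_def)
  ultimately have "card R \<le> p" using card_inj_on_le[of c R "{..<p}"] by simp
  then show False using R by (simp add: cliques_def)
qed

text \<open>With \<open>C v\<close> the part of \<open>v\<close>, the vector \<open>1 / (t + card (C v))\<close> is an eigenvector for \<open>t\<close> as soon as
  its entries sum to \<open>1\<close>; such a \<open>t > 0\<close> exists by the intermediate value theorem.\<close>

lemma partite_eigenvector:
  assumes V: "finite V" and part: "partite V c p" and uw: "u \<in> V" "w \<in> V" "E u w"
  shows "\<exists>(\<mu>::real) y. \<mu> > 0 \<and> (\<forall>v\<in>V. y v > 0) \<and> (\<forall>v\<in>V. \<mu> * y v = (\<Sum>x\<in>nbhd V v. y x))"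
proof -
  define C where "C v = {x \<in> V. c x = c v}" for v
  define h where "h t = (\<Sum>v\<in>V. 1 / (t + real (card (C v))))" for t :: real
  have fC: "finite (C v)" for v using V by (simp add: C_def)
  have c1: "card (C v) \<ge> 1" if "v \<in> V" for v
    using that card_gt_0_iff[of "C v"] fC by (force simp: C_def)
  have Ceq: "C x = C v" if "x \<in> C v" for x v using that by (auto simp: C_def)
  have sumC: "(\<Sum>x\<in>C v. 1 / (t + real (card (C x)))) = real (card (C v)) / (t + real (card (C v)))" for t v
    using Ceq by simp
  have "c u \<noteq> c w" using part uw by (auto simp: partite_def)
  then have wC: "w \<notin> C u" by (auto simp: C_def)
  \<comment> \<open>At \<open>0\<close> each part contributes exactly \<open>1\<close>; the part of
    \<open>u\<close> together with the single term of \<open>w\<close>, which lies in another part,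
    already exceeds \<open>1\<close>.\<close>
  have "h 0 > 1"
  proof -
    have "1 = (\<Sum>x\<in>C u. 1 / (0 + real (card (C x))))" using sumC[of 0 u] c1[OF uw(1)] by simp
    also have "\<dots> < 1 / (0 + real (card (C w))) + (\<Sum>x\<in>C u. 1 / (0 + real (card (C x))))"
      using c1[OF uw(2)] by simp
    also have "\<dots> = (\<Sum>x\<in>insert w (C u). 1 / (0 + real (card (C x))))"
      using wC fC by simp
    also have "\<dots> \<le> h 0" unfolding h_def
      using V uw by (intro sum_mono2) (auto simp: C_def)
    finally show ?thesis .
  qed
  moreover have "h (card V) \<le> 1"
  proof -
    have "card V > 0" using V uw by (auto simp: card_gt_0_iff)
    then have "h (card V) \<le> (\<Sum>v\<in>V. 1 / real (card V))"
      unfolding h_def by (intro sum_mono divide_left_mono) auto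
    then show ?thesis using \<open>card V > 0\<close> by simp
  qed
  moreover have "continuous_on {0..real (card V)} h"
    unfolding h_def using c1 by (intro continuous_intros) fastforce
  ultimately obtain t where t: "0 \<le> t" "h t = 1"
    using IVT2'[of h "real (card V)" 1 0] by auto
  have "t \<noteq> 0" using t \<open>h 0 > 1\<close> by auto
  then have "t > 0" using t by simp
  define y where "y v = 1 / (t + real (card (C v)))" for v
  \<comment> \<open>The neighbours of \<open>v\<close> are the vertices outside \<open>C v\<close>.
    As all entries sum to \<open>1\<close>, theirs sum to \<open>1\<close> minus the share of
    \<open>C v\<close>, which is \<open>t * y v\<close>.\<close>
  have "t * y v = (\<Sum>x\<in>nbhd V v. y x)" if v: "v \<in> V" for v
  proof -
    have "nbhd V v = V - C v" using part v by (auto simp: nbhd_def partite_def C_def)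
    moreover have "C v \<subseteq> V" by (auto simp: C_def)
    ultimately have "(\<Sum>x\<in>nbhd V v. y x) = (\<Sum>x\<in>V. y x) - (\<Sum>x\<in>C v. y x)"
      using V by (simp add: sum_diff)
    also have "\<dots> = 1 - real (card (C v)) / (t + real (card (C v)))"
      using t(2) sumC[of t v] by (simp add: h_def y_def)
    also have "\<dots> = t * y v" using \<open>t > 0\<close> by (simp add: y_def field_simps)
    finally show ?thesis by simp
  qed
  moreover have "\<forall>v\<in>V. y v > 0" using \<open>t > 0\<close> by (simp add: y_def add_pos_nonneg)
  ultimately show ?thesis using \<open>t > 0\<close> by blast
qed

end

section \<open>Isomorphisms and spectral radii of pair graphs\<close>

text \<open>Bijections between colour classes of equal size are glued. Between complete multipartite
  graphs a bijection preserving colours is an isomorphism.\<close>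

lemma bij_betw_fibres:
  fixes c :: "'a \<Rightarrow> nat" and d :: "'b \<Rightarrow> nat"
  assumes fin: "finite V" "finite W"
    and bound: "\<And>u. u \<in> V \<Longrightarrow> c u < r" "\<And>w. w \<in> W \<Longrightarrow> d w < r"
    and card: "\<And>i. i < r \<Longrightarrow> card {u \<in> V. c u = i} = card {w \<in> W. d w = i}"
  shows "\<exists>f. bij_betw f V W \<and> (\<forall>u\<in>V. d (f u) = c u)"
proof -
  have "\<exists>g. bij_betw g {u \<in> V. c u = i} {w \<in> W. d w = i}" if "i < r" for i
    using finite_same_card_bij[OF _ _ card[OF that]] fin by simp
  then obtain g where g: "\<And>i. i < r \<Longrightarrow> bij_betw (g i) {u \<in> V. c u = i} {w \<in> W. d w = i}"
    by metis
  define f where "f u = g (c u) u" for u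
  have fW: "f u \<in> W" "d (f u) = c u" if "u \<in> V" for u
    using bij_betwE[OF g[OF bound(1)[OF that]]] that by (auto simp: f_def)
  have "inj_on f V"
  proof (rule inj_onI)
    fix u v assume uv: "u \<in> V" "v \<in> V" "f u = f v"
    then have "c u = c v" using fW by metis
    then show "u = v"
      using uv g[OF bound(1)[OF uv(1)]] by (auto simp: f_def bij_betw_def inj_on_def)
  qed
  moreover have "f ` V = W"
  proof
    show "f ` V \<subseteq> W" using fW by auto
    show "W \<subseteq> f ` V"
    proof
      fix w assume w: "w \<in> W"
      have "w \<in> g (d w) ` {u \<in> V. c u = d w}"
        using bij_betw_imp_surj_on[OF g[OF bound(2)[OF w]]] w by simp
      then obtain u where u: "w = g (d w) u" "u \<in> V" "c u = d w" by auto
      then have "w = f u" by (simp add: f_def)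
      then show "w \<in> f ` V" using u(2) by (rule image_eqI)
    qed
  qed
  ultimately show ?thesis using fW by (auto simp: bij_betw_def)
qed

text \<open>\<open>digraph_iso\<close> carries an arc map and tail and head functions of its own.
  Here tail and head are \<open>fst\<close> and \<open>snd\<close> on both sides, so the vertex map
  determines the arc map.\<close>

lemma digraph_iso_with_proj_iff:
  assumes "pair_wf_digraph G" "pair_wf_digraph H"
  shows "digraph_iso (with_proj G) (with_proj H) \<longleftrightarrow>
    (\<exists>f. bij_betw f (pverts G) (pverts H) \<and>
      (\<forall>u\<in>pverts G. \<forall>v\<in>pverts G. (u, v) \<in> parcs G \<longleftrightarrow> (f u, f v) \<in> parcs H))"
proof
  assume "digraph_iso (with_proj G) (with_proj H)"
  then obtain h where h: "pre_digraph.digraph_isomorphism (with_proj G) h"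
    and H: "with_proj H = app_iso h (with_proj G)"
    by (auto simp: digraph_iso_def)
  define f where "f = iso_verts h"
  have "verts (with_proj H) = f ` pverts G" "arcs (with_proj H) = iso_arcs h ` parcs G"
    "tail (with_proj H) = iso_tail h" "head (with_proj H) = iso_head h"
    unfolding H f_def by simp_all
  then have vH: "pverts H = f ` pverts G" and aH: "parcs H = iso_arcs h ` parcs G"
    and th: "iso_tail h = fst" "iso_head h = snd" by simp_all
  have inj: "inj_on f (pverts G)"
    using h by (simp add: pre_digraph.digraph_isomorphism_def f_def)
  have "iso_arcs h a = (f (fst a), f (snd a))" if "a \<in> parcs G" for a
    using h that th by (auto simp: pre_digraph.digraph_isomorphism_def f_def prod_eq_iff)
  then have aH': "parcs H = (\<lambda>a. (f (fst a), f (snd a))) ` parcs G"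
    unfolding aH by (rule image_cong[OF refl])
  have "(u, v) \<in> parcs G \<longleftrightarrow> (f u, f v) \<in> parcs H" if "u \<in> pverts G" "v \<in> pverts G" for u v
  proof
    assume "(u, v) \<in> parcs G"
    then show "(f u, f v) \<in> parcs H" unfolding aH' by force
  next
    assume "(f u, f v) \<in> parcs H"
    then obtain x y where xy: "(x, y) \<in> parcs G" "f u = f x" "f v = f y" unfolding aH' by auto
    then have "x \<in> pverts G" "y \<in> pverts G"
      using assms(1) by (auto dest: pair_wf_digraph.in_arcsD1 pair_wf_digraph.in_arcsD2)
    then show "(u, v) \<in> parcs G" using xy inj that by (metis inj_onD)
  qed
  then show "\<exists>f. bij_betw f (pverts G) (pverts H) \<and>
      (\<forall>u\<in>pverts G. \<forall>v\<in>pverts G. (u, v) \<in> parcs G \<longleftrightarrow> (f u, f v) \<in> parcs H)"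
    using inj vH by (auto simp: bij_betw_def intro!: exI[of _ f])
next
  assume "\<exists>f. bij_betw f (pverts G) (pverts H) \<and>
      (\<forall>u\<in>pverts G. \<forall>v\<in>pverts G. (u, v) \<in> parcs G \<longleftrightarrow> (f u, f v) \<in> parcs H)"
  then obtain f where f: "bij_betw f (pverts G) (pverts H)"
    "\<And>u v. u \<in> pverts G \<Longrightarrow> v \<in> pverts G \<Longrightarrow> (u, v) \<in> parcs G \<longleftrightarrow> (f u, f v) \<in> parcs H"
    by blast
  have inj: "inj_on f (pverts G)" and surj: "f ` pverts G = pverts H"
    using f(1) by (auto simp: bij_betw_def)
  have G: "u \<in> pverts G" "v \<in> pverts G" if "(u, v) \<in> parcs G" for u v
    using that assms(1) by (auto dest: pair_wf_digraph.in_arcsD1 pair_wf_digraph.in_arcsD2)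
  have Hv: "u \<in> pverts H" "v \<in> pverts H" if "(u, v) \<in> parcs H" for u v
    using that assms(2) by (auto dest: pair_wf_digraph.in_arcsD1 pair_wf_digraph.in_arcsD2)
  define h where "h = \<lparr>iso_verts = f, iso_arcs = map_prod f f, iso_head = snd, iso_tail = fst\<rparr>"
  have inj': "inj_on (map_prod f f) (parcs G)"
  proof (rule inj_onI)
    fix a b assume ab: "a \<in> parcs G" "b \<in> parcs G" "map_prod f f a = map_prod f f b"
    have "fst a = fst b" "snd a = snd b"
      using ab(3) G[of "fst a" "snd a"] G[of "fst b" "snd b"] ab(1,2) inj_onD[OF inj]
      by (simp_all add: map_prod_def case_prod_beta)
    then show "a = b" by (rule prod_eqI)
  qed
  have "pre_digraph.digraph_isomorphism (with_proj G) h"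
    using assms(1) inj inj' by (simp add: pre_digraph.digraph_isomorphism_def wf_digraph_wp_iff h_def)
  moreover have "map_prod f f ` parcs G = parcs H"
  proof
    show "map_prod f f ` parcs G \<subseteq> parcs H"
    proof
      fix a assume "a \<in> map_prod f f ` parcs G"
      then obtain u v where "(u, v) \<in> parcs G" "a = (f u, f v)" by auto
      then show "a \<in> parcs H" using f(2)[OF G] by blast
    qed
    show "parcs H \<subseteq> map_prod f f ` parcs G"
    proof
      fix a assume a: "a \<in> parcs H"
      obtain x y where xy: "a = (x, y)" by (meson surj_pair)
      have "x \<in> f ` pverts G" "y \<in> f ` pverts G" using Hv[of x y] a surj xy by simp_all
      then obtain u v where uv: "u \<in> pverts G" "x = f u" "v \<in> pverts G" "y = f v" by blast
      then have "(u, v) \<in> parcs G" using f(2)[OF uv(1,3)] a xy by blast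
      moreover have "a = map_prod f f (u, v)" using xy uv by simp
      ultimately show "a \<in> map_prod f f ` parcs G" by blast
    qed
  qed
  then have "with_proj H = app_iso h (with_proj G)"
    using surj by (simp add: app_iso_def h_def with_proj_def)
  ultimately show "digraph_iso (with_proj G) (with_proj H)" by (auto simp: digraph_iso_def)
qed

text \<open>Eigenvectors are functions on vertices, which frees the spectrum from any enumeration of
  the vertices.\<close>

definition graph_eigenvalue :: "'a pair_pre_digraph \<Rightarrow> complex \<Rightarrow> bool" where
  "graph_eigenvalue G \<mu> \<longleftrightarrow> (\<exists>z. (\<exists>v\<in>pverts G. z v \<noteq> 0) \<and>
    (\<forall>v\<in>pverts G. (\<Sum>w\<in>{w \<in> pverts G. (v, w) \<in> parcs G}. z w) = \<mu> * z v))"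

lemma adjacency_mat_mult_vec:
  assumes "distinct vs" "set vs = pverts G" "i < length vs"
  shows "(adjacency_mat vs G *\<^sub>v vec (length vs) (\<lambda>j. z (vs ! j))) $ i =
    (\<Sum>w\<in>{w \<in> pverts G. (vs ! i, w) \<in> parcs G}. z w)"
proof -
  have fin: "finite (pverts G)" using assms(2) by (metis List.finite_set)
  have "(adjacency_mat vs G *\<^sub>v vec (length vs) (\<lambda>j. z (vs ! j))) $ i =
      (\<Sum>j\<in>{..<length vs}. if (vs ! i, vs ! j) \<in> parcs G then z (vs ! j) else 0)"
    using assms(3) by (auto simp: adjacency_mat_def scalar_prod_def atLeast0LessThan intro!: sum.cong)
  also have "\<dots> = (\<Sum>w\<in>pverts G. if (vs ! i, w) \<in> parcs G then z w else 0)"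
    using assms(1,2) by (intro sum.reindex_bij_betw bij_betw_nth) auto
  also have "\<dots> = (\<Sum>w\<in>{w \<in> pverts G. (vs ! i, w) \<in> parcs G}. z w)"
    by (rule sum.inter_filter[OF fin, symmetric])
  finally show ?thesis .
qed

text \<open>Vertex functions are read off along \<open>vs\<close>. Since \<open>vs\<close> has no
  repetitions, every vector of matching dimension arises in this way.\<close>

lemma eigenvalue_adjacency_mat:
  assumes "distinct vs" "set vs = pverts G"
  shows "eigenvalue (adjacency_mat vs G) \<mu> \<longleftrightarrow> graph_eigenvalue G \<mu>"
proof -
  let ?n = "length vs" and ?A = "adjacency_mat vs G"
  have dim: "dim_row ?A = ?n" by (simp add: adjacency_mat_def)
  have ev: "eigenvector ?A (vec ?n (\<lambda>j. z (vs ! j))) \<mu> \<longleftrightarrow>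
      (\<exists>v\<in>pverts G. z v \<noteq> 0) \<and>
      (\<forall>v\<in>pverts G. (\<Sum>w\<in>{w \<in> pverts G. (v, w) \<in> parcs G}. z w) = \<mu> * z v)" for z
  proof -
    let ?x = "vec ?n (\<lambda>j. z (vs ! j))"
    have "?x \<noteq> 0\<^sub>v ?n \<longleftrightarrow> (\<exists>i<?n. z (vs ! i) \<noteq> 0)"
      by (auto simp: vec_eq_iff)
    also have "\<dots> \<longleftrightarrow> (\<exists>v\<in>pverts G. z v \<noteq> 0)"
      unfolding assms(2)[symmetric] by (metis in_set_conv_nth)
    finally have 1: "?x \<noteq> 0\<^sub>v ?n \<longleftrightarrow> (\<exists>v\<in>pverts G. z v \<noteq> 0)" .
    have "?A *\<^sub>v ?x = \<mu> \<cdot>\<^sub>v ?x \<longleftrightarrow> (\<forall>i<?n. (?A *\<^sub>v ?x) $ i = \<mu> * z (vs ! i))"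
      unfolding vec_eq_iff by (auto simp: dim)
    also have "\<dots> \<longleftrightarrow> (\<forall>i<?n. (\<Sum>w\<in>{w \<in> pverts G. (vs ! i, w) \<in> parcs G}. z w) = \<mu> * z (vs ! i))"
      using adjacency_mat_mult_vec[OF assms] by simp
    also have "\<dots> \<longleftrightarrow> (\<forall>v\<in>pverts G. (\<Sum>w\<in>{w \<in> pverts G. (v, w) \<in> parcs G}. z w) = \<mu> * z v)"
      unfolding assms(2)[symmetric] by (simp only: all_set_conv_all_nth)
    finally show ?thesis using 1 by (simp add: eigenvector_def dim)
  qed
  have "\<exists>z. x = vec ?n (\<lambda>j. z (vs ! j))" if "x \<in> carrier_vec ?n" for x :: "complex vec"
  proof
    have "the_inv_into {..<?n} ((!) vs) (vs ! j) = j" if "j < ?n" for j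
      using that assms(1) by (intro the_inv_into_f_f) (auto simp: inj_on_def nth_eq_iff_index_eq)
    then show "x = vec ?n (\<lambda>j. (\<lambda>v. x $ the_inv_into {..<?n} ((!) vs) v) (vs ! j))"
      using that by (intro eq_vecI) auto
  qed
  then have repr: "\<exists>z. x = vec ?n (\<lambda>j. z (vs ! j))" if "eigenvector ?A x \<mu>" for x
    using that dim by (simp add: eigenvector_def)
  have "eigenvalue ?A \<mu> \<longleftrightarrow> (\<exists>z. eigenvector ?A (vec ?n (\<lambda>j. z (vs ! j))) \<mu>)"
    unfolding eigenvalue_def
  proof
    assume "\<exists>x. eigenvector ?A x \<mu>"
    then obtain x where x: "eigenvector ?A x \<mu>" ..
    from repr[OF x] obtain z where "x = vec ?n (\<lambda>j. z (vs ! j))" ..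
    with x show "\<exists>z. eigenvector ?A (vec ?n (\<lambda>j. z (vs ! j))) \<mu>" by blast
  qed blast
  then show ?thesis unfolding ev graph_eigenvalue_def .
qed

section \<open>Spectral radius independently of the enumeration and up to isomorphism\<close>

lemma some_enumeration:
  assumes "finite A"
  shows "distinct (SOME vs. distinct vs \<and> set vs = A)" "set (SOME vs. distinct vs \<and> set vs = A) = A"
proof -
  have "\<exists>vs. distinct vs \<and> set vs = A" using finite_distinct_list[OF assms] by blast
  from someI_ex[OF this]
  show "distinct (SOME vs. distinct vs \<and> set vs = A)" "set (SOME vs. distinct vs \<and> set vs = A) = A"
    by blast+
qed

lemma graph_spectral_radius_eq:
  assumes "finite (pverts G)"
  shows "graph_spectral_radius G = Max (cmod ` {\<mu>. graph_eigenvalue G \<mu>})"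
proof -
  have "eigenvalue (adjacency_mat (SOME vs. distinct vs \<and> set vs = pverts G) G) = graph_eigenvalue G"
    using eigenvalue_adjacency_mat[OF some_enumeration[OF assms]] by (rule ext)
  then show ?thesis
    by (simp add: graph_spectral_radius_def spectral_radius_def spectrum_def)
qed

lemma graph_spectral_radius_mem_max:
  assumes "finite (pverts G)" "pverts G \<noteq> {}"
  shows "\<exists>\<mu>. graph_eigenvalue G \<mu> \<and> cmod \<mu> = graph_spectral_radius G"
    and "graph_eigenvalue G \<mu> \<Longrightarrow> cmod \<mu> \<le> graph_spectral_radius G"
proof -
  define vs where "vs = (SOME vs. distinct vs \<and> set vs = pverts G)"
  have vs: "distinct vs" "set vs = pverts G"
    unfolding vs_def by (rule some_enumeration[OF assms(1)])+
  have car: "adjacency_mat vs G \<in> carrier_mat (length vs) (length vs)"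
    by (simp add: adjacency_mat_def)
  have len: "length vs > 0" using vs assms(2) by auto
  have "eigenvalue (adjacency_mat vs G) = graph_eigenvalue G"
    using eigenvalue_adjacency_mat[OF vs] by (rule ext)
  then have spec: "spectrum (adjacency_mat vs G) = {\<mu>. graph_eigenvalue G \<mu>}"
    by (simp add: spectrum_def)
  have gsr: "graph_spectral_radius G = spectral_radius (adjacency_mat vs G)"
    by (simp add: graph_spectral_radius_def vs_def)
  show "\<exists>\<mu>. graph_eigenvalue G \<mu> \<and> cmod \<mu> = graph_spectral_radius G"
    using spectral_radius_mem_max(1)[OF car len] unfolding spec gsr by auto
  show "graph_eigenvalue G \<mu> \<Longrightarrow> cmod \<mu> \<le> graph_spectral_radius G"
    using spectral_radius_mem_max(2)[OF car len, of "cmod \<mu>"] unfolding spec gsr by auto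
qed

lemma graph_eigenvalue_pullback:
  assumes f: "bij_betw f (pverts G) (pverts H)"
    and adj: "\<And>u v. u \<in> pverts G \<Longrightarrow> v \<in> pverts G \<Longrightarrow> (u, v) \<in> parcs G \<longleftrightarrow> (f u, f v) \<in> parcs H"
    and ev: "graph_eigenvalue H \<mu>"
  shows "graph_eigenvalue G \<mu>"
proof -
  obtain z where z: "\<exists>v\<in>pverts H. z v \<noteq> 0"
    "\<forall>v\<in>pverts H. (\<Sum>w\<in>{w \<in> pverts H. (v, w) \<in> parcs H}. z w) = \<mu> * z v"
    using ev by (auto simp: graph_eigenvalue_def)
  have fH: "f v \<in> pverts H" if "v \<in> pverts G" for v using bij_betwE[OF f] that by blast
  have "(\<Sum>w\<in>{w \<in> pverts G. (v, w) \<in> parcs G}. z (f w)) = \<mu> * z (f v)" if v: "v \<in> pverts G" for v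
  proof -
    have "bij_betw f {w \<in> pverts G. (v, w) \<in> parcs G} {w \<in> pverts H. (f v, w) \<in> parcs H}"
    proof (rule bij_betw_imageI)
      show "inj_on f {w \<in> pverts G. (v, w) \<in> parcs G}"
        using bij_betw_imp_inj_on[OF f] by (rule inj_on_subset) auto
      show "f ` {w \<in> pverts G. (v, w) \<in> parcs G} = {w \<in> pverts H. (f v, w) \<in> parcs H}"
      proof
        show "f ` {w \<in> pverts G. (v, w) \<in> parcs G} \<subseteq> {w \<in> pverts H. (f v, w) \<in> parcs H}"
          using adj[OF v] fH by auto
        show "{w \<in> pverts H. (f v, w) \<in> parcs H} \<subseteq> f ` {w \<in> pverts G. (v, w) \<in> parcs G}"
        proof
          fix x assume x: "x \<in> {w \<in> pverts H. (f v, w) \<in> parcs H}"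
          then obtain w where w: "w \<in> pverts G" "x = f w"
            using bij_betw_imp_surj_on[OF f] by auto
          then show "x \<in> f ` {w \<in> pverts G. (v, w) \<in> parcs G}" using adj[OF v w(1)] x by simp
        qed
      qed
    qed
    from sum.reindex_bij_betw[OF this, of z] show ?thesis using z(2) fH[OF v] by simp
  qed
  moreover have "\<exists>v\<in>pverts G. z (f v) \<noteq> 0"
  proof -
    obtain x where x: "x \<in> pverts H" "z x \<noteq> 0" using z(1) by blast
    then obtain v where "v \<in> pverts G" "x = f v" using bij_betw_imp_surj_on[OF f] by auto
    with x(2) show ?thesis by blast
  qed
  ultimately show ?thesis unfolding graph_eigenvalue_def by (intro exI[of _ "\<lambda>v. z (f v)"]) blast
qed

lemma digraph_iso_graph_spectral_radius:
  assumes "pair_fin_digraph G" "pair_fin_digraph H" "digraph_iso (with_proj G) (with_proj H)"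
  shows "graph_spectral_radius G = graph_spectral_radius H"
proof -
  interpret G: pair_fin_digraph G by fact
  interpret H: pair_fin_digraph H by fact
  \<comment> \<open>Fresh vertex types allow the fact to be used in both directions, although
    \<open>G\<close> and \<open>H\<close> live over different types.\<close>
  have pull: "graph_eigenvalue X \<mu>"
    if iso: "digraph_iso (with_proj X) (with_proj Y)" and wf: "pair_wf_digraph X" "pair_wf_digraph Y"
      and ev: "graph_eigenvalue Y \<mu>"
    for X :: "'c pair_pre_digraph" and Y :: "'d pair_pre_digraph" and \<mu>
  proof -
    obtain f where "bij_betw f (pverts X) (pverts Y)"
      "\<forall>u\<in>pverts X. \<forall>v\<in>pverts X. (u, v) \<in> parcs X \<longleftrightarrow> (f u, f v) \<in> parcs Y"
      using iso unfolding digraph_iso_with_proj_iff[OF wf] by blast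
    then show ?thesis using graph_eigenvalue_pullback[of f X Y \<mu>] ev by blast
  qed
  have "digraph_iso (with_proj H) (with_proj G)"
    using digraph_iso_swap[OF _ assms(3)] G.wf_digraph_axioms by blast
  then have "graph_eigenvalue G \<mu> \<longleftrightarrow> graph_eigenvalue H \<mu>" for \<mu>
    using pull[OF assms(3)] pull[of H G] G.pair_wf_digraph_axioms H.pair_wf_digraph_axioms by blast
  then show ?thesis
    using graph_spectral_radius_eq[OF G.pair_finite_verts] graph_spectral_radius_eq[OF H.pair_finite_verts]
    by simp
qed

section \<open>The extremal graph\<close>

abbreviation adj :: "'a pair_pre_digraph \<Rightarrow> 'a \<Rightarrow> 'a \<Rightarrow> bool" where
  "adj G u v \<equiv> (u, v) \<in> parcs G"

section \<open>Pair graphs as symmetric relations\<close>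

lemma sym_rel_adj:
  assumes "pair_graph G"
  shows "sym_rel (adj G)"
proof -
  interpret pair_graph G by fact
  show ?thesis
    by unfold_locales (use sym_arcs in \<open>auto simp: symmetric_def dest: symD no_loops'\<close>)
qed

lemma edge_count_eq_card_cliques:
  assumes "pair_graph G"
  shows "edge_count G = card (sym_rel.cliques (adj G) (pverts G) 2)"
proof -
  interpret pair_graph G by fact
  interpret E: sym_rel "adj G" by (rule sym_rel_adj[OF assms])
  have "{{u, v} | u v. (u, v) \<in> parcs G} = E.cliques (pverts G) 2"
  proof (intro equalityI subsetI)
    fix R assume "R \<in> {{u, v} | u v. (u, v) \<in> parcs G}"
    then obtain u v where uv: "R = {u, v}" "(u, v) \<in> parcs G" by blast
    then have "u \<noteq> v" "(v, u) \<in> parcs G" "u \<in> pverts G" "v \<in> pverts G"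
      using E.irrefl E.sym in_arcsD1 in_arcsD2 by blast+
    then show "R \<in> E.cliques (pverts G) 2" using uv by (auto simp: E.cliques_def)
  next
    fix R assume R: "R \<in> E.cliques (pverts G) 2"
    then obtain u v where "R = {u, v}" "u \<noteq> v" by (auto simp: E.cliques_def card_2_iff)
    with R show "R \<in> {{u, v} | u v. (u, v) \<in> parcs G}" by (auto simp: E.cliques_def)
  qed
  then show ?thesis by (simp add: edge_count_def)
qed

lemma complete_free_cliques:
  assumes "pair_graph G" "complete_free m G"
  shows "sym_rel.cliques (adj G) (pverts G) m = {}"
proof (rule equals0I)
  interpret pair_graph G by fact
  interpret E: sym_rel "adj G" by (rule sym_rel_adj[OF assms(1)])
  fix R assume R: "R \<in> E.cliques (pverts G) m"
  define H where "H = \<lparr>pverts = R, parcs = {(u, v). (u, v) \<in> R \<times> R \<and> u \<noteq> v}\<rparr>"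
  have RV: "R \<subseteq> pverts G" "card R = m" using R by (simp_all add: E.cliques_def)
  moreover have "finite R" using RV(1) pair_finite_verts by (rule finite_subset)
  ultimately have "K\<^bsub>m\<^esub> (with_proj H)" by (simp add: complete_digraph_pair_def H_def)
  moreover have "subgraph (with_proj H) (with_proj G)"
  proof (rule subgraphI)
    show "wf_digraph (with_proj H)"
      unfolding wf_digraph_wp_iff by unfold_locales (auto simp: H_def)
    show "wf_digraph (with_proj G)" by unfold_locales
    show "verts (with_proj H) \<subseteq> verts (with_proj G)" using RV by (simp add: H_def)
    show "arcs (with_proj H) \<subseteq> arcs (with_proj G)" using R by (auto simp: H_def E.cliques_def)
    show "compatible (with_proj G) (with_proj H)" by (simp add: compatible_def)
  qed
  ultimately show False using assms(2) by (auto simp: complete_free_def)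
qed

lemma max_degree_nbhd:
  assumes "pair_graph G" "pverts G \<noteq> {}"
  shows "u \<in> pverts G \<Longrightarrow> card (sym_rel.nbhd (adj G) (pverts G) u) \<le> max_degree G"
    and "\<exists>v\<in>pverts G. card (sym_rel.nbhd (adj G) (pverts G) v) = max_degree G"
proof -
  interpret pair_graph G by fact
  interpret E: sym_rel "adj G" by (rule sym_rel_adj[OF assms(1)])
  have deg: "out_degree (with_proj G) u = card (E.nbhd (pverts G) u)" for u
  proof -
    have "out_arcs (with_proj G) u = Pair u ` E.nbhd (pverts G) u"
      by (auto simp: out_arcs_def E.nbhd_def in_arcsD2)
    then show ?thesis by (simp add: out_degree_def card_image inj_on_def)
  qed
  show "u \<in> pverts G \<Longrightarrow> card (E.nbhd (pverts G) u) \<le> max_degree G"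
    unfolding max_degree_def deg using pair_finite_verts by (intro Max_ge) auto
  have "max_degree G \<in> (\<lambda>u. card (E.nbhd (pverts G) u)) ` pverts G"
    unfolding max_degree_def deg using pair_finite_verts assms(2) by (intro Max_in) auto
  then show "\<exists>v\<in>pverts G. card (E.nbhd (pverts G) v) = max_degree G" by force
qed

text \<open>The vector consists of the moduli of an eigenvector for an eigenvalue of largest
  modulus; the triangle inequality turns the eigenvalue equation into an inequality.\<close>

lemma spectral_radius_subeigenvector:
  assumes "finite (pverts G)" "pverts G \<noteq> {}"
  shows "\<exists>y. (\<forall>v. y v \<ge> 0) \<and> (\<Sum>v\<in>pverts G. y v) > 0 \<and>
    (\<forall>v\<in>pverts G. graph_spectral_radius G * y v \<le> (\<Sum>w\<in>{w \<in> pverts G. adj G v w}. y w))"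
proof -
  obtain \<mu> z where \<mu>: "cmod \<mu> = graph_spectral_radius G"
    and z: "\<exists>v\<in>pverts G. z v \<noteq> 0"
      "\<forall>v\<in>pverts G. (\<Sum>w\<in>{w \<in> pverts G. (v, w) \<in> parcs G}. z w) = \<mu> * z v"
    using graph_spectral_radius_mem_max(1)[OF assms] by (auto simp: graph_eigenvalue_def)
  obtain v where v: "v \<in> pverts G" "z v \<noteq> 0" using z(1) by blast
  have "0 < cmod (z v)" using v by simp
  also have "\<dots> \<le> (\<Sum>v\<in>pverts G. cmod (z v))"
    using assms(1) v(1) by (intro member_le_sum) auto
  finally have "(\<Sum>v\<in>pverts G. cmod (z v)) > 0" .
  moreover have "graph_spectral_radius G * cmod (z v) \<le> (\<Sum>w\<in>{w \<in> pverts G. adj G v w}. cmod (z w))"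
    if "v \<in> pverts G" for v
  proof -
    have "graph_spectral_radius G * cmod (z v) = cmod (\<Sum>w\<in>{w \<in> pverts G. adj G v w}. z w)"
      using z(2) that by (simp add: norm_mult \<mu>)
    also have "\<dots> \<le> (\<Sum>w\<in>{w \<in> pverts G. adj G v w}. cmod (z w))" by (rule norm_sum)
    finally show ?thesis .
  qed
  ultimately show ?thesis by (intro exI[of _ "\<lambda>v. cmod (z v)"]) auto
qed

lemma le_graph_spectral_radius:
  assumes "finite (pverts G)" "u \<in> pverts G" "y u \<noteq> 0" "t \<ge> 0"
    and "\<And>v. v \<in> pverts G \<Longrightarrow> t * y v = (\<Sum>w\<in>{w \<in> pverts G. adj G v w}. y w)"
  shows "t \<le> graph_spectral_radius G"
proof -
  have "graph_eigenvalue G (complex_of_real t)"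
    unfolding graph_eigenvalue_def
    using assms(2,3) by (intro exI[of _ "\<lambda>v. complex_of_real (y v)"])
      (auto simp flip: of_real_sum of_real_mult assms(5))
  from graph_spectral_radius_mem_max(2)[OF assms(1) _ this] show ?thesis using assms(2,4) by auto
qed

text \<open>The independent part receives the last colour \<open>p\<close>, in line with the sizes
  \<open>(bal \<Delta> p)(p := n - \<Delta>)\<close> of \<open>max_degree_step\<close>.\<close>

definition S_colour :: "nat \<Rightarrow> nat + nat \<Rightarrow> nat" where
  "S_colour p x = (case x of Inl _ \<Rightarrow> p | Inr u \<Rightarrow> u mod p)"

lemma pair_graph_S_graph: "pair_graph (S_graph r n \<Delta>)"
  unfolding S_graph_def
  by (intro pair_graph_graph_join pair_graph_edgeless pair_graph_turan_graph)

lemma pverts_S_graph: "pverts (S_graph r n \<Delta>) = Inl ` {..<n - \<Delta>} \<union> Inr ` {..<\<Delta>}"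
  by (auto simp: S_graph_def graph_join_def edgeless_def turan_graph_def)

lemma adj_S_graph:
  assumes "p > 0" "x \<in> pverts (S_graph (Suc p) n \<Delta>)" "y \<in> pverts (S_graph (Suc p) n \<Delta>)"
  shows "adj (S_graph (Suc p) n \<Delta>) x y \<longleftrightarrow> S_colour p x \<noteq> S_colour p y"
proof -
  have "u mod p \<noteq> p" for u using assms(1) by (simp add: less_imp_neq)
  moreover have "p \<noteq> u mod p" for u using assms(1) by (metis mod_less_divisor less_irrefl)
  ultimately show ?thesis
    using assms(2,3) unfolding pverts_S_graph
    by (auto simp: S_graph_def graph_join_def edgeless_def turan_graph_def S_colour_def)
qed

lemma S_graph_partite:
  assumes "p > 0"
  shows "sym_rel.partite (adj (S_graph (Suc p) n \<Delta>)) (pverts (S_graph (Suc p) n \<Delta>)) (S_colour p) (Suc p)"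
proof -
  interpret S: sym_rel "adj (S_graph (Suc p) n \<Delta>)" by (rule sym_rel_adj[OF pair_graph_S_graph])
  have "S_colour p x < Suc p" for x
    using assms by (auto simp: S_colour_def less_Suc_eq split: sum.splits)
  then show ?thesis using adj_S_graph[OF assms] by (simp add: S.partite_def)
qed

lemma card_S_colour:
  assumes "p > 0" "i < Suc p"
  shows "card {x \<in> pverts (S_graph (Suc p) n \<Delta>). S_colour p x = i} = ((bal \<Delta> p)(p := n - \<Delta>)) i"
proof (cases "i = p")
  case True
  have "u mod p \<noteq> p" for u using assms(1) by (simp add: less_imp_neq)
  then have "{x \<in> pverts (S_graph (Suc p) n \<Delta>). S_colour p x = i} = Inl ` {..<n - \<Delta>}"
    unfolding pverts_S_graph by (auto simp: S_colour_def True)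
  then show ?thesis using True by (simp add: card_image)
next
  case False
  then have "{x \<in> pverts (S_graph (Suc p) n \<Delta>). S_colour p x = i} = Inr ` {u. u < \<Delta> \<and> u mod p = i}"
    unfolding pverts_S_graph by (auto simp: S_colour_def)
  then show ?thesis using False by (simp add: card_image bal_def)
qed

lemma turan_number_eq:
  assumes "p > 0"
  shows "turan_number m p = coeff (parts_poly (bal m p) p) 2"
proof -
  let ?T = "turan_graph m p"
  interpret T: sym_rel "adj ?T" by (rule sym_rel_adj[OF pair_graph_turan_graph])
  have "T.partite (pverts ?T) (\<lambda>u. u mod p) p"
    unfolding T.partite_def using assms by (auto simp: turan_graph_def)
  moreover have "finite (pverts ?T)" by (simp add: turan_graph_def)
  moreover have "(\<lambda>i. card {u \<in> pverts ?T. u mod p = i}) = bal m p"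
    by (simp add: bal_def turan_graph_def fun_eq_iff)
  ultimately show ?thesis
    using T.partite_card_cliques[of "pverts ?T" "\<lambda>u. u mod p" p 2]
    by (simp add: turan_number_def edge_count_eq_card_cliques[OF pair_graph_turan_graph])
qed

lemma S_graph_card_cliques:
  assumes "p > 0"
  shows "card (sym_rel.cliques (adj (S_graph (Suc p) n \<Delta>)) (pverts (S_graph (Suc p) n \<Delta>)) s) =
    coeff (parts_poly ((bal \<Delta> p)(p := n - \<Delta>)) (Suc p)) s"
proof -
  let ?S = "S_graph (Suc p) n \<Delta>"
  interpret S: sym_rel "adj ?S" by (rule sym_rel_adj[OF pair_graph_S_graph])
  have fin: "finite (pverts ?S)" by (simp add: pverts_S_graph)
  have "parts_poly (\<lambda>i. card {x \<in> pverts ?S. S_colour p x = i}) (Suc p) =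
      parts_poly ((bal \<Delta> p)(p := n - \<Delta>)) (Suc p)"
    unfolding parts_poly_def using card_S_colour[OF assms] by (intro prod.cong) auto
  then show ?thesis using S.partite_card_cliques[OF fin S_graph_partite[OF assms]] by simp
qed

text \<open>The linear factor of the part of size \<open>n - \<Delta>\<close> contributes
  \<open>n - \<Delta>\<close> times the coefficient of index \<open>1\<close>, which is the total
  \<open>\<Delta>\<close> of the other sizes.\<close>

lemma edge_count_S_graph:
  assumes "p > 0"
  shows "edge_count (S_graph (Suc p) n \<Delta>) = (n - \<Delta>) * \<Delta> + turan_number \<Delta> p"
proof -
  have "parts_poly ((bal \<Delta> p)(p := n - \<Delta>)) (Suc p) = [:1, n - \<Delta>:] * parts_poly (bal \<Delta> p) p"
    unfolding parts_poly_Suc by (simp add: parts_poly_def)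
  then have "edge_count (S_graph (Suc p) n \<Delta>) = coeff ([:1, n - \<Delta>:] * parts_poly (bal \<Delta> p) p) (Suc 1)"
    using S_graph_card_cliques[OF assms, of n \<Delta> 2]
    by (simp only: edge_count_eq_card_cliques[OF pair_graph_S_graph] numeral_2_eq_2 One_nat_def)
  then show ?thesis
    unfolding coeff_linear_mult_Suc turan_number_eq[OF assms]
    by (simp add: coeff_1_parts_poly sum_bal[OF assms] numeral_2_eq_2)
qed

theorem theorem1p6:
  fixes r n \<Delta> :: nat and G :: "'a pair_pre_digraph"
  assumes "r \<ge> 2"
    and "\<lceil>(real r - 1) * real n / real r\<rceil> \<le> int \<Delta>"
    and "int \<Delta> \<le> int n - 1"
    and "pair_graph G"
    and "card (pverts G) = n"
    and "complete_free (r + 1) G"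
    and "max_degree G = \<Delta>"
  shows "(edge_count G \<le> edge_count (S_graph r n \<Delta>)
          \<and> edge_count (S_graph r n \<Delta>) = (n - \<Delta>) * \<Delta> + turan_number \<Delta> (r - 1)
          \<and> (edge_count G = edge_count (S_graph r n \<Delta>)
               \<longleftrightarrow> digraph_iso (with_proj G) (with_proj (S_graph r n \<Delta>))))
       \<and> (graph_spectral_radius G \<le> graph_spectral_radius (S_graph r n \<Delta>)
          \<and> (graph_spectral_radius G = graph_spectral_radius (S_graph r n \<Delta>)
               \<longleftrightarrow> digraph_iso (with_proj G) (with_proj (S_graph r n \<Delta>))))"
proof -
  define p where "p = r - 1"
  have r: "r = Suc p" and p: "p > 0" using assms(1) by (auto simp: p_def)
  let ?S = "S_graph (Suc p) n \<Delta>"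
  let ?V = "pverts G" and ?W = "pverts (S_graph (Suc p) n \<Delta>)"
  interpret G: pair_graph G by fact
  interpret S: pair_graph ?S by (rule pair_graph_S_graph)
  interpret A: sym_rel "adj G" by (rule sym_rel_adj[OF assms(4)])
  interpret B: sym_rel "adj ?S" by (rule sym_rel_adj[OF pair_graph_S_graph])
  have n: "\<Delta> < n" using assms(3) by linarith
  have ne: "?V \<noteq> {}" using n assms(5) by auto
  \<comment> \<open>Since \<open>r \<ge> 2\<close>, the lower bound on \<open>\<Delta>\<close> is
    positive. Both sides of the join are thus nonempty, which gives an edge of \<open>?S\<close> and
    with it a positive eigenvalue.\<close>
  have \<Delta>: "\<Delta> > 0"
  proof -
    have "0 < (real r - 1) * real n / real r" using n assms(1) by simp
    then have "0 < \<lceil>(real r - 1) * real n / real r\<rceil>" by simp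
    then show ?thesis using assms(2) by linarith
  qed
  define N where "N = (bal \<Delta> p)(p := n - \<Delta>)"
  have kS: "card (B.cliques ?W s) = coeff (parts_poly N (Suc p)) s" for s
    unfolding N_def by (rule S_graph_card_cliques[OF p])
  have free: "A.cliques ?V (Suc (Suc p)) = {}"
    using complete_free_cliques[OF assms(4,6)] r by simp
  obtain v where v: "v \<in> ?V" "card (A.nbhd ?V v) = \<Delta>"
    using max_degree_nbhd(2)[OF assms(4) ne] assms(7) by blast
  have deg: "card (A.nbhd ?V u) \<le> \<Delta>" if "u \<in> ?V" for u
    using max_degree_nbhd(1)[OF assms(4) ne that] assms(7) by simp
  have step: "(\<forall>s. card (A.cliques ?V s) \<le> coeff (parts_poly N (Suc p)) s) \<and>
      (card (A.cliques ?V 2) = coeff (parts_poly N (Suc p)) 2 \<longrightarrow>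
        (\<exists>c. A.partite ?V c (Suc p) \<and> (\<forall>i<Suc p. card {u \<in> ?V. c u = i} = N i)))"
    unfolding N_def assms(5)[symmetric]
    by (rule A.max_degree_step[OF G.pair_finite_verts A.zykov_turan free deg v])
  have le: "card (A.cliques ?V s) \<le> card (B.cliques ?W s)" for s
    using step kS by simp
  have wf: "pair_wf_digraph G" "pair_wf_digraph ?S"
    using G.pair_wf_digraph_axioms S.pair_wf_digraph_axioms by auto
  have iso: "digraph_iso (with_proj G) (with_proj ?S)"
    if eq2: "card (A.cliques ?V 2) = card (B.cliques ?W 2)"
  proof -
    obtain c where c: "A.partite ?V c (Suc p)" "\<forall>i<Suc p. card {u \<in> ?V. c u = i} = N i"
      using step eq2 unfolding kS by blast
    have d: "B.partite ?W (S_colour p) (Suc p)" by (rule S_graph_partite[OF p])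
    have "\<exists>f. bij_betw f ?V ?W \<and> (\<forall>u\<in>?V. S_colour p (f u) = c u)"
    proof (rule bij_betw_fibres)
      show "c u < Suc p" if "u \<in> ?V" for u using c(1) that by (simp add: A.partite_def)
      show "S_colour p w < Suc p" if "w \<in> ?W" for w using d that by (simp add: B.partite_def)
      show "card {u \<in> ?V. c u = i} = card {w \<in> ?W. S_colour p w = i}" if "i < Suc p" for i
        using c(2) card_S_colour[OF p that, of n \<Delta>] that by (simp add: N_def)
    qed (rule G.pair_finite_verts S.pair_finite_verts)+
    then obtain f where f: "bij_betw f ?V ?W" "\<And>u. u \<in> ?V \<Longrightarrow> S_colour p (f u) = c u" by blast
    have "adj G u w \<longleftrightarrow> adj ?S (f u) (f w)" if "u \<in> ?V" "w \<in> ?V" for u w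
    proof -
      have "adj G u w \<longleftrightarrow> c u \<noteq> c w" using c(1) that by (simp add: A.partite_def)
      moreover have "adj ?S (f u) (f w) \<longleftrightarrow> S_colour p (f u) \<noteq> S_colour p (f w)"
        using bij_betwE[OF f(1)] that by (intro adj_S_graph[OF p]) auto
      ultimately show ?thesis using f(2) that by simp
    qed
    then show ?thesis unfolding digraph_iso_with_proj_iff[OF wf] using f(1) by blast
  qed
  have edge: "edge_count G = card (A.cliques ?V 2)" "edge_count ?S = card (B.cliques ?W 2)"
    by (rule edge_count_eq_card_cliques[OF assms(4)], rule edge_count_eq_card_cliques[OF pair_graph_S_graph])
  \<comment> \<open>As \<open>le\<close> gives one inequality, it suffices that the images of the
    edges of \<open>G\<close> under \<open>f\<close> cover the edges of \<open>?S\<close>.\<close>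
  have iso_edge: "edge_count G = edge_count ?S" if iso: "digraph_iso (with_proj G) (with_proj ?S)"
  proof -
    obtain f where f: "bij_betw f ?V ?W" "\<And>u w. u \<in> ?V \<Longrightarrow> w \<in> ?V \<Longrightarrow> adj G u w \<longleftrightarrow> adj ?S (f u) (f w)"
      using iso unfolding digraph_iso_with_proj_iff[OF wf] by blast
    have "B.cliques ?W 2 \<subseteq> image f ` A.cliques ?V 2"
    proof
      fix R assume R: "R \<in> B.cliques ?W 2"
      define Q where "Q = {u \<in> ?V. f u \<in> R}"
      have fQ: "f ` Q = R"
        using R bij_betw_imp_surj_on[OF f(1)] by (auto simp: Q_def B.cliques_def)
      have inj: "inj_on f Q" using bij_betw_imp_inj_on[OF f(1)] by (rule inj_on_subset) (auto simp: Q_def)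
      have "card Q = 2" using card_image[OF inj] fQ R by (simp add: B.cliques_def)
      moreover have "adj G u w" if "u \<in> Q" "w \<in> Q" "u \<noteq> w" for u w
      proof -
        have "f u \<noteq> f w" using inj that by (auto dest: inj_onD)
        then have "adj ?S (f u) (f w)" using that R by (simp add: Q_def B.cliques_def)
        then show ?thesis using f(2)[of u w] that by (simp add: Q_def)
      qed
      ultimately have "Q \<in> A.cliques ?V 2" by (simp add: A.cliques_def) (auto simp: Q_def)
      then show "R \<in> image f ` A.cliques ?V 2" using fQ by blast
    qed
    then have "card (B.cliques ?W 2) \<le> card (image f ` A.cliques ?V 2)"
      using A.finite_cliques[OF G.pair_finite_verts] by (intro card_mono) auto
    also have "\<dots> \<le> card (A.cliques ?V 2)"
      using A.finite_cliques[OF G.pair_finite_verts] by (rule card_image_le)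
    finally show ?thesis using le[of 2] edge by simp
  qed
  have edge_iff: "edge_count G = edge_count ?S \<longleftrightarrow> digraph_iso (with_proj G) (with_proj ?S)"
    using iso iso_edge edge by auto
  have xy: "Inl 0 \<in> ?W" "Inr 0 \<in> ?W" "adj ?S (Inl 0) (Inr 0)"
  proof -
    show 1: "Inl 0 \<in> ?W" "Inr 0 \<in> ?W" using n \<Delta> by (auto simp: pverts_S_graph)
    show "adj ?S (Inl 0) (Inr 0)" using adj_S_graph[OF p 1] p by (simp add: S_colour_def)
  qed
  \<comment> \<open>Nothing beyond \<open>t \<le> graph_spectral_radius ?S\<close> is shown about
    the place of \<open>t\<close> in the spectrum; together with
    \<open>graph_spectral_radius G \<le> t\<close> this gives the bound.\<close>
  obtain t y where t: "t > (0::real)" "\<forall>v\<in>?W. y v > 0" "\<forall>v\<in>?W. t * y v = (\<Sum>x\<in>B.nbhd ?W v. y x)"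
    using B.partite_eigenvector[OF S.pair_finite_verts S_graph_partite[OF p] xy] by blast
  have Weq: "t ^ Suc p = (\<Sum>s<Suc p. real s * real (card (B.cliques ?W (Suc s))) * t ^ (Suc p - Suc s))"
  proof (rule B.spectral_clique_partite[OF S.pair_finite_verts S_graph_partite[OF p]])
    show "(\<Sum>v\<in>?W. y v) > 0" using t(2) S.pair_finite_verts xy(1) by (intro sum_pos) auto
    show "B.cliques ?W (Suc (Suc p)) = {}"
      by (rule B.partite_no_large_clique[OF S.pair_finite_verts S_graph_partite[OF p]])
  qed (use t in auto)
  have tS: "t \<le> graph_spectral_radius ?S"
    using t xy(1) by (intro le_graph_spectral_radius[OF S.pair_finite_verts, of "Inl 0" y])
      (auto simp: B.nbhd_def)
  obtain z where z: "\<forall>v. z v \<ge> 0" "(\<Sum>v\<in>?V. z v) > 0"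
    "\<forall>v\<in>?V. graph_spectral_radius G * z v \<le> (\<Sum>w\<in>{w \<in> ?V. adj G v w}. z w)"
    using spectral_radius_subeigenvector[OF G.pair_finite_verts ne] by blast
  have \<rho>: "graph_spectral_radius G \<ge> 0"
    using graph_spectral_radius_mem_max(1)[OF G.pair_finite_verts ne] by (metis norm_ge_zero)
  have Gle: "graph_spectral_radius G ^ Suc p \<le>
      (\<Sum>s<Suc p. real s * real (card (A.cliques ?V (Suc s))) * graph_spectral_radius G ^ (Suc p - Suc s))"
    using z \<rho> free by (intro A.spectral_clique_bound[OF G.pair_finite_verts]) (auto simp: A.nbhd_def)
  have "{Inl 0, Inr 0} \<in> B.cliques ?W (Suc 1)"
    using xy B.sym[OF xy(3)] by (auto simp: B.cliques_def)
  then have pos: "card (B.cliques ?W (Suc 1)) > 0"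
    using B.finite_cliques[OF S.pair_finite_verts] by (auto simp: card_gt_0_iff)
  have cmp: "graph_spectral_radius G \<le> t \<and> (graph_spectral_radius G = t \<longrightarrow>
      real (card (A.cliques ?V (Suc 1))) = real (card (B.cliques ?W (Suc 1))))"
    using le pos p by (intro compare_roots[OF \<rho> Gle t(1) Weq]) auto
  have spec_iff: "graph_spectral_radius G = graph_spectral_radius ?S \<longleftrightarrow> digraph_iso (with_proj G) (with_proj ?S)"
  proof
    assume "graph_spectral_radius G = graph_spectral_radius ?S"
    \<comment> \<open>Equal spectral radii squeeze \<open>t\<close> between them, so
      \<open>graph_spectral_radius G = t\<close> and \<open>cmp\<close> equates the numbers of
      edges.\<close>
    then have "card (A.cliques ?V (Suc 1)) = card (B.cliques ?W (Suc 1))" using cmp tS by simp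
    then show "digraph_iso (with_proj G) (with_proj ?S)" using iso by (simp add: numeral_2_eq_2)
  next
    assume "digraph_iso (with_proj G) (with_proj ?S)"
    then show "graph_spectral_radius G = graph_spectral_radius ?S"
      by (rule digraph_iso_graph_spectral_radius[OF G.pair_fin_digraph_axioms S.pair_fin_digraph_axioms])
  qed
  show ?thesis
    unfolding r using edge le[of 2] edge_count_S_graph[OF p, of n \<Delta>] edge_iff cmp tS spec_iff by simp
qed

end
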